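(* Let $k$ be a field containing $\frac16$. If $t_1$ and $t_2$ are two translations in the affine group $\mathrm{Aff}(k)$, then $||[t_1,t_2]||=0$.
   Context: $\mathrm{Aff}(k)$ is the group of transformations of $k$ of the form $z\mapsto az+b$ with $a\in k^*$, $b\in k$; a translation is an element $z\mapsto z+b$. Two commuting elements $g,h$ of a group $G$ overcommute if any lifts of $g,h$ to any central extension of $G$ commute. Any two translations in $\mathrm{Aff}(k)$ overcommute when $\frac16\in k$. Simplicial volume of an overcommuting pair $(g,h)$ in a group $G$: let $BG$ be a classifying space of $G$ and let $f:S^1\times S^1\to BG$ be a continuous map such that $f_*$ maps the two standard generators of $\pi_1(S^1\times S^1)$ to $g$ and $h$ respectively. For $\epsilon>0$ let $X_\epsilon$ be the set of singular cycles $x=\sum_i\lambda_i\sigma_i\in Z_2(S^1\times S^1,\mathbb{R})$ representing the fundamental class $[S^1\times S^1]$ and such that $\sum_i|\lambda_i|\le\epsilon$. Define $$||f||_\epsilon=\inf\Big\{\sum_j|\mu_j| : y=\sum_j\mu_j\sigma_j\in C_3(BG,\mathbb{R}),\ \partial y\in f_*X_\epsilon\Big\}$$ and $||[g,h]||=\liminf_{\epsilon\to0}||f||_\epsilon$. *)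

theory Defs
  imports "HOL-Homology.Homology" "HOL-Library.Extended_Real"
begin

section \<open>The affine group\<close>

definition affine_group :: "('k::field \<Rightarrow> 'k) monoid" where
  "affine_group = \<lparr>carrier = {\<lambda>z. a * z + b | a b. a \<noteq> 0}, mult = (\<circ>), one = id\<rparr>"

definition affine_translations :: "('k::field \<Rightarrow> 'k) set" where
  "affine_translations = {\<lambda>z. z + b | b. True}"

lemma affine_groupI: "a \<noteq> 0 \<Longrightarrow> (\<lambda>z. a * z + b) \<in> carrier (affine_group :: ('k::field \<Rightarrow> 'k) monoid)"
  unfolding affine_group_def by auto

lemma affine_translations_subset:
  "affine_translations \<subseteq> carrier (affine_group :: ('k::field \<Rightarrow> 'k) monoid)"
proof
  fix t :: "'k \<Rightarrow> 'k" assume "t \<in> affine_translations"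
  then obtain b where "t = (\<lambda>z. 1 * z + b)" by (auto simp: affine_translations_def)
  then show "t \<in> carrier affine_group"
    using affine_groupI[of 1 b] by simp
qed

lemma group_affine_group: "group (affine_group :: ('k::field \<Rightarrow> 'k) monoid)"
proof (rule groupI)
  fix x y :: "'k \<Rightarrow> 'k"
  assume "x \<in> carrier affine_group" "y \<in> carrier affine_group"
  then obtain a b c d where xy: "a \<noteq> 0" "x = (\<lambda>z. a * z + b)" "c \<noteq> 0" "y = (\<lambda>z. c * z + d)"
    unfolding affine_group_def by auto
  then have "x \<otimes>\<^bsub>affine_group\<^esub> y = (\<lambda>z. (a * c) * z + (a * d + b))"
    by (simp add: affine_group_def fun_eq_iff algebra_simps)
  then show "x \<otimes>\<^bsub>affine_group\<^esub> y \<in> carrier affine_group"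
    using affine_groupI[of "a * c" "a * d + b"] xy by simp
next
  have "\<one>\<^bsub>affine_group\<^esub> = (\<lambda>z::'k. 1 * z + 0)" by (simp add: affine_group_def fun_eq_iff)
  then show "\<one>\<^bsub>affine_group\<^esub> \<in> carrier (affine_group :: ('k \<Rightarrow> 'k) monoid)"
    using affine_groupI[of "1::'k" 0] by simp
next
  fix x :: "'k \<Rightarrow> 'k"
  assume "x \<in> carrier affine_group"
  then obtain a b where ab: "a \<noteq> 0" "x = (\<lambda>z. a * z + b)"
    unfolding affine_group_def by auto
  let ?y = "\<lambda>z. inverse a * z + (- inverse a * b)"
  have "inverse a * (a * z + b) + - inverse a * b = z" for z
    using ab(1) by (simp add: distrib_left flip: mult.assoc)
  then have "?y \<otimes>\<^bsub>affine_group\<^esub> x = \<one>\<^bsub>affine_group\<^esub>"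
    by (simp add: affine_group_def fun_eq_iff ab(2))
  moreover have "?y \<in> carrier affine_group"
    using ab(1) by (intro affine_groupI) simp
  ultimately show "\<exists>y\<in>carrier affine_group. y \<otimes>\<^bsub>affine_group\<^esub> x = \<one>\<^bsub>affine_group\<^esub>"
    by (intro bexI)
qed (simp_all add: affine_group_def comp_assoc)


section \<open>Fundamental group and classifying spaces\<close>

definition path_class :: "'b::topological_space set \<Rightarrow> (real \<Rightarrow> 'b) \<Rightarrow> (real \<Rightarrow> 'b) set" where
  "path_class S p = {q. homotopic_paths S p q}"

definition fundamental_group :: "'b::topological_space set \<Rightarrow> 'b \<Rightarrow> (real \<Rightarrow> 'b) set monoid" where
  "fundamental_group S x0 =
     \<lparr>carrier = {path_class S p | p. path p \<and> path_image p \<subseteq> S \<and> pathstart p = x0 \<and> pathfinish p = x0},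
      mult = (\<lambda>A B. {r. \<exists>p\<in>A. \<exists>q\<in>B. homotopic_paths S (p +++ q) r}),
      one = path_class S (\<lambda>_. x0)\<rparr>"

text \<open>
  A classifying space of the discrete group \<open>G\<close> is a \<open>K(G,1)\<close>: a path-connected space with an
  identification \<open>\<phi>\<close> of its fundamental group with \<open>G\<close> and with vanishing higher homotopy groups,
  that is, with every map from a sphere of dimension at least 2 homotopic to a constant.
  No CW structure is required.
\<close>

definition classifying_space ::
  "('g, 'm) monoid_scheme \<Rightarrow> 'b::topological_space set \<Rightarrow> 'b \<Rightarrow> ((real \<Rightarrow> 'b) set \<Rightarrow> 'g) \<Rightarrow> bool" where
  "classifying_space G S x0 \<phi> \<longleftrightarrow>
     x0 \<in> S \<and> path_connected S \<and>
     \<phi> \<in> iso (fundamental_group S x0) G \<and>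
     (\<forall>n\<ge>2. \<forall>s. continuous_map (nsphere n) (top_of_set S) s \<longrightarrow>
        (\<exists>c. homotopic_with (\<lambda>_. True) (nsphere n) (top_of_set S) s (\<lambda>_. c)))"


section \<open>Singular chains with real coefficients\<close>

text \<open>
  The real analogues of \<^const>\<open>singular_chain\<close>, \<^const>\<open>chain_boundary\<close> and \<^const>\<open>chain_map\<close>, which are
  only available over the integers; simplices, faces and push-forwards of simplices are the
  library ones.
\<close>

type_synonym 'a real_chain = "((nat \<Rightarrow> real) \<Rightarrow> 'a) \<Rightarrow>\<^sub>0 real"

definition real_singular_chain :: "nat \<Rightarrow> 'a topology \<Rightarrow> 'a real_chain \<Rightarrow> bool" where
  "real_singular_chain p X c \<longleftrightarrow> Poly_Mapping.keys c \<subseteq> Collect (singular_simplex p X)"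

definition real_chain_boundary :: "nat \<Rightarrow> 'a real_chain \<Rightarrow> 'a real_chain" where
  "real_chain_boundary p c =
     (if p = 0 then 0 else
      \<Sum>\<sigma>\<in>Poly_Mapping.keys c. \<Sum>k\<le>p.
        Poly_Mapping.single (singular_face p k \<sigma>) ((-1) ^ k * Poly_Mapping.lookup c \<sigma>))"

definition real_chain_map :: "nat \<Rightarrow> ('a \<Rightarrow> 'b) \<Rightarrow> 'a real_chain \<Rightarrow> 'b real_chain" where
  "real_chain_map p f c =
     (\<Sum>\<sigma>\<in>Poly_Mapping.keys c. Poly_Mapping.single (simplex_map p f \<sigma>) (Poly_Mapping.lookup c \<sigma>))"

definition l1_norm :: "'a real_chain \<Rightarrow> real" where
  "l1_norm c = (\<Sum>\<sigma>\<in>Poly_Mapping.keys c. \<bar>Poly_Mapping.lookup c \<sigma>\<bar>)"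


section \<open>The torus and its fundamental class\<close>

definition torus :: "(complex \<times> complex) set" where
  "torus = sphere 0 1 \<times> sphere 0 1"

definition torus_loop1 :: "real \<Rightarrow> complex \<times> complex" where
  "torus_loop1 t = (cis (2 * pi * t), 1)"

definition torus_loop2 :: "real \<Rightarrow> complex \<times> complex" where
  "torus_loop2 t = (1, cis (2 * pi * t))"

text \<open>
  The unit square cut along its diagonal into the triangles with ordered vertices
  \<open>(0,0), (1,0), (1,1)\<close> and \<open>(0,0), (0,1), (1,1)\<close>, wrapped onto the torus. With the signs \<open>+\<close> and
  \<open>-\<close> these form a cycle representing the fundamental class for the product orientation.
\<close>

definition torus_simplex1 :: "(nat \<Rightarrow> real) \<Rightarrow> complex \<times> complex" where
  "torus_simplex1 =
     restrict (\<lambda>x. (cis (2 * pi * (x 1 + x 2)), cis (2 * pi * x 2))) (standard_simplex 2)"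

definition torus_simplex2 :: "(nat \<Rightarrow> real) \<Rightarrow> complex \<times> complex" where
  "torus_simplex2 =
     restrict (\<lambda>x. (cis (2 * pi * x 2), cis (2 * pi * (x 1 + x 2)))) (standard_simplex 2)"

definition torus_cycle :: "(complex \<times> complex) real_chain" where
  "torus_cycle = Poly_Mapping.single torus_simplex1 1 - Poly_Mapping.single torus_simplex2 1"

definition represents_torus_class :: "(complex \<times> complex) real_chain \<Rightarrow> bool" where
  "represents_torus_class x \<longleftrightarrow>
     real_singular_chain 2 (top_of_set torus) x \<and> real_chain_boundary 2 x = 0 \<and>
     (\<exists>w. real_singular_chain 3 (top_of_set torus) w \<and> x - torus_cycle = real_chain_boundary 3 w)"

lemma singular_simplex_torus:
  "singular_simplex 2 (top_of_set torus) torus_simplex1"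
  "singular_simplex 2 (top_of_set torus) torus_simplex2"
proof -
  have p: "continuous_on A (\<lambda>x::nat \<Rightarrow> real. x i)" for A i
    by (rule continuous_on_subset[OF continuous_on_product_coordinates]) simp
  have "continuous_on (standard_simplex 2)
          (\<lambda>x. (cis (2 * pi * (x 1 + x 2)), cis (2 * pi * x 2)))"
    by (intro continuous_on_Pair continuous_on_cis continuous_intros p)
  then show "singular_simplex 2 (top_of_set torus) torus_simplex1"
    unfolding singular_simplex_def torus_simplex1_def
    by (simp add: euclidean_product_topology continuous_map_in_subtopology torus_def
        image_subset_iff)
  have "continuous_on (standard_simplex 2)
          (\<lambda>x. (cis (2 * pi * x 2), cis (2 * pi * (x 1 + x 2))))"
    by (intro continuous_on_Pair continuous_on_cis continuous_intros p)
  then show "singular_simplex 2 (top_of_set torus) torus_simplex2"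
    unfolding singular_simplex_def torus_simplex2_def
    by (simp add: euclidean_product_topology continuous_map_in_subtopology torus_def
        image_subset_iff)
qed

lemma torus_cycle_boundary: "real_chain_boundary 2 torus_cycle = 0"
proof -
  let ?s1 = torus_simplex1 and ?s2 = torus_simplex2
  define u :: "nat \<Rightarrow> real" where "u = (\<lambda>i. if i = 0 then 3/4 else if i = 1 then 1/4 else 0)"
  have "(\<Sum>i\<le>2. u i) = 1"
    by (simp add: u_def numeral_2_eq_2)
  then have u: "u \<in> standard_simplex 2"
    by (auto simp: standard_simplex_def u_def)
  have "?s1 u \<noteq> ?s2 u"
    using u by (simp add: torus_simplex1_def torus_simplex2_def u_def complex_eq_iff)
  then have ne: "?s1 \<noteq> ?s2" by auto
  have keys: "Poly_Mapping.keys torus_cycle = {?s1, ?s2}"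
    using ne by (auto simp: torus_cycle_def in_keys_iff lookup_minus lookup_single when_def)
  have l: "Poly_Mapping.lookup torus_cycle ?s1 = 1" "Poly_Mapping.lookup torus_cycle ?s2 = -1"
    using ne by (auto simp: torus_cycle_def lookup_minus lookup_single when_def)
  have sum: "x 0 + x (Suc 0) = 1" if "x \<in> standard_simplex (Suc 0)" for x
    using that by (simp add: standard_simplex_def)
  have face: "singular_face 2 k g = restrict (\<lambda>x. g (simplical_face k x)) (standard_simplex (Suc 0))"
    for g :: "(nat \<Rightarrow> real) \<Rightarrow> complex \<times> complex" and k
    by (simp add: singular_face_def o_def)
  have f02: "singular_face 2 0 ?s1 = singular_face 2 2 ?s2"
    unfolding torus_simplex1_def torus_simplex2_def
    by simp (auto simp: face simplical_face_def sum simp del: restrict_apply intro!: restrict_ext)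
  have f20: "singular_face 2 2 ?s1 = singular_face 2 0 ?s2"
    unfolding torus_simplex1_def torus_simplex2_def
    by simp (auto simp: face simplical_face_def sum simp del: restrict_apply intro!: restrict_ext)
  have f11: "singular_face 2 1 ?s1 = singular_face 2 1 ?s2"
    unfolding torus_simplex1_def torus_simplex2_def
    by simp (auto simp: face simplical_face_def simp del: restrict_apply intro!: restrict_ext)
  have "{..2::nat} = {0, 1, 2}" by auto
  then show ?thesis
    using ne f02 f20 f11
    by (simp add: real_chain_boundary_def keys l single_uminus)
qed


section \<open>The simplicial volume\<close>

definition small_torus_cycles :: "real \<Rightarrow> (complex \<times> complex) real_chain set" where
  "small_torus_cycles \<epsilon> = {x. represents_torus_class x \<and> l1_norm x \<le> \<epsilon>}"

text \<open>
  The infimum is taken in \<^typ>\<open>ereal\<close>, so that it is infinite when no filling exists.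
\<close>

definition filling_norm ::
  "'b::topological_space set \<Rightarrow> (complex \<times> complex \<Rightarrow> 'b) \<Rightarrow> real \<Rightarrow> ereal" where
  "filling_norm S f \<epsilon> =
     Inf {ereal (l1_norm y) | y.
       real_singular_chain 3 (top_of_set S) y \<and>
       real_chain_boundary 3 y \<in> real_chain_map 2 f ` small_torus_cycles \<epsilon>}"

definition simplicial_volume ::
  "'b::topological_space set \<Rightarrow> (complex \<times> complex \<Rightarrow> 'b) \<Rightarrow> ereal" where
  "simplicial_volume S f = Liminf (at_right 0) (filling_norm S f)"

text \<open>
  \<open>f\<close> maps the torus to \<open>S\<close>, based at \<open>(1,1)\<close> and \<open>x0\<close>, and under the identification \<open>\<phi>\<close> of the
  fundamental group of \<open>S\<close> it sends the two standard generators to \<open>g\<close> and \<open>h\<close>.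
\<close>

definition torus_map_for ::
  "'b::topological_space set \<Rightarrow> 'b \<Rightarrow> ((real \<Rightarrow> 'b) set \<Rightarrow> 'g) \<Rightarrow> 'g \<Rightarrow> 'g
     \<Rightarrow> (complex \<times> complex \<Rightarrow> 'b) \<Rightarrow> bool" where
  "torus_map_for S x0 \<phi> g h f \<longleftrightarrow>
     continuous_map (top_of_set torus) (top_of_set S) f \<and> f (1, 1) = x0 \<and>
     \<phi> (path_class S (f \<circ> torus_loop1)) = g \<and> \<phi> (path_class S (f \<circ> torus_loop2)) = h"

end

theory Submission
  imports Defs
begin

text \<open>
  Let \<open>c\<close> be the standard 2-cycle of the torus and \<open>D\<close> the doubling map of the torus, and let
  \<open>f\<close> be a map from the torus to the classifying space \<open>S\<close> that sends the generators to translations.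

  The class of a commuting pair is bilinear, so \<open>D\<^sub>* c = 4 c + \<partial>w\<close> on the torus
  (\<open>double_torus_cycle_homologous\<close>). On the other hand the homothety \<open>z \<mapsto> z / 2\<close> conjugates the square
  of every translation to the translation itself. As \<open>S\<close> is a \<open>K(G,1)\<close>, it follows that
  \<open>f \<circ> D\<close> is freely homotopic to \<open>f\<close>, and cutting the homotopy into tetrahedra shows that
  \<open>(f \<circ> D)\<^sub>* c = f\<^sub>* c + \<partial>y\<close> with \<open>y\<close> of norm at most \<open>6\<close> (\<open>doubling_homologous\<close>).
  Comparing the two, \<open>3 f\<^sub>* c\<close> is the boundary of \<open>y - f\<^sub>* w\<close>, whose norm is bounded
  independently of \<open>f\<close> (\<open>bounded_filling\<close>).

  The cycles \<open>4\<^sup>-\<^sup>m D\<^sup>m\<^sub>* c\<close> represent the fundamental class and have norm at most \<open>2 / 4\<^sup>m\<close>. Their images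
  under \<open>f\<close> are \<open>4\<^sup>-\<^sup>m (f \<circ> D\<^sup>m)\<^sub>* c\<close>, where \<open>f \<circ> D\<^sup>m\<close> again sends the generators to
  translations, so they bound chains of norm at most a constant times \<open>4\<^sup>-\<^sup>m\<close>
  (\<open>filling_shrunk_cycles\<close>). Hence the infimum that defines the simplicial volume vanishes already
  for every fixed \<open>\<epsilon> > 0\<close>.
\<close>

section \<open>Real singular chains as a normed complex\<close>

text \<open>
  Chains are finitely supported functions, and their boundary, push-forward and norm are sums over
  the support. Enlarging the support by simplices with coefficient \<open>0\<close> changes none of these sums,
  which is what makes boundary and push-forward linear.
\<close>

lemma sum_keys_superset:
  assumes "finite A" "Poly_Mapping.keys c \<subseteq> A" "\<And>x. g x 0 = 0"
  shows "(\<Sum>x\<in>Poly_Mapping.keys c. g x (Poly_Mapping.lookup c x)) = (\<Sum>x\<in>A. g x (Poly_Mapping.lookup c x))"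
  using assms by (intro sum.mono_neutral_left) (auto simp: in_keys_iff)

lemma sum_keys_add:
  fixes c d :: "'a \<Rightarrow>\<^sub>0 real"
  assumes "\<And>x. g x 0 = 0" "\<And>x r s. g x (r + s) = g x r + g x s"
  shows "(\<Sum>x\<in>Poly_Mapping.keys (c + d). g x (Poly_Mapping.lookup (c + d) x)) =
    (\<Sum>x\<in>Poly_Mapping.keys c. g x (Poly_Mapping.lookup c x)) +
    (\<Sum>x\<in>Poly_Mapping.keys d. g x (Poly_Mapping.lookup d x))"
proof -
  let ?A = "Poly_Mapping.keys c \<union> Poly_Mapping.keys d"
  have "Poly_Mapping.keys (c + d) \<subseteq> ?A" by (rule Poly_Mapping.keys_add)
  then show ?thesis
    using sum_keys_superset[of ?A "c + d" g] sum_keys_superset[of ?A c g]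
      sum_keys_superset[of ?A d g] assms
    by (simp add: lookup_add sum.distrib)
qed

text \<open>
  Multiplication of a chain by a real number.
\<close>

definition scale_chain :: "real \<Rightarrow> 'a real_chain \<Rightarrow> 'a real_chain" where
  "scale_chain a c = Poly_Mapping.map ((*) a) c"

lemma lookup_scale_chain [simp]:
  "Poly_Mapping.lookup (scale_chain a c) \<sigma> = a * Poly_Mapping.lookup c \<sigma>"
  by (simp add: scale_chain_def map.rep_eq when_def)

lemma keys_scale_chain: "Poly_Mapping.keys (scale_chain a c) \<subseteq> Poly_Mapping.keys c"
  by (auto simp: in_keys_iff)

lemma scale_chain_eqs:
  "scale_chain a (c + d) = scale_chain a c + scale_chain a d"
  "scale_chain a (c - d) = scale_chain a c - scale_chain a d"
  "scale_chain a (scale_chain b c) = scale_chain (a * b) c"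
  "scale_chain a 0 = 0"
  "scale_chain 1 c = c"
  by (rule poly_mapping_eqI; simp add: lookup_add lookup_minus algebra_simps)+

lemma scale_chain_single [simp]:
  "scale_chain a (Poly_Mapping.single \<sigma> r) = Poly_Mapping.single \<sigma> (a * r)"
  by (rule poly_mapping_eqI) (simp add: lookup_single when_def)

lemma scale_chain_sum: "scale_chain a (sum h A) = (\<Sum>i\<in>A. scale_chain a (h i))"
  by (induction A rule: infinite_finite_induct) (simp_all add: scale_chain_eqs)

lemma real_chain_boundary_zero [simp]: "real_chain_boundary p 0 = 0"
  by (simp add: real_chain_boundary_def)

lemma real_chain_boundary_single:
  "real_chain_boundary p (Poly_Mapping.single \<sigma> r) = (if p = 0 then 0 else
     \<Sum>k\<le>p. Poly_Mapping.single (singular_face p k \<sigma>) ((-1) ^ k * r))"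
  by (simp add: real_chain_boundary_def)

lemma real_chain_boundary_add:
  "real_chain_boundary p (c + d) = real_chain_boundary p c + real_chain_boundary p d"
  using sum_keys_add[of "\<lambda>\<sigma> r. \<Sum>k\<le>p. Poly_Mapping.single (singular_face p k \<sigma>) ((-1) ^ k * r)" c d]
  by (simp add: real_chain_boundary_def single_add sum.distrib distrib_left)

lemma real_chain_boundary_scale:
  "real_chain_boundary p (scale_chain a c) = scale_chain a (real_chain_boundary p c)"
  using sum_keys_superset[OF finite_keys keys_scale_chain, of
      "\<lambda>\<sigma> r. \<Sum>k\<le>p. Poly_Mapping.single (singular_face p k \<sigma>) ((-1) ^ k * r)" a c]
  by (simp add: real_chain_boundary_def scale_chain_sum scale_chain_eqs mult.left_commute)

lemma diff_scale_chain: "c - d = c + scale_chain (-1) d"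
  by (rule poly_mapping_eqI) (simp add: lookup_add lookup_minus)

lemma real_chain_boundary_diff:
  "real_chain_boundary p (c - d) = real_chain_boundary p c - real_chain_boundary p d"
  by (simp add: diff_scale_chain real_chain_boundary_add real_chain_boundary_scale)

lemma real_chain_boundary_sum:
  "real_chain_boundary p (sum h A) = (\<Sum>i\<in>A. real_chain_boundary p (h i))"
  by (induction A rule: infinite_finite_induct) (simp_all add: real_chain_boundary_add)

lemma real_chain_map_zero [simp]: "real_chain_map p f 0 = 0"
  by (simp add: real_chain_map_def)

lemma real_chain_map_single [simp]:
  "real_chain_map p f (Poly_Mapping.single \<sigma> r) = Poly_Mapping.single (simplex_map p f \<sigma>) r"
  by (simp add: real_chain_map_def)

lemma real_chain_map_add:
  "real_chain_map p f (c + d) = real_chain_map p f c + real_chain_map p f d"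
  using sum_keys_add[of "\<lambda>\<sigma> r. Poly_Mapping.single (simplex_map p f \<sigma>) r" c d]
  by (simp add: real_chain_map_def single_add)

lemma real_chain_map_scale:
  "real_chain_map p f (scale_chain a c) = scale_chain a (real_chain_map p f c)"
  using sum_keys_superset[OF finite_keys keys_scale_chain, of
      "\<lambda>\<sigma> r. Poly_Mapping.single (simplex_map p f \<sigma>) r" a c]
  by (simp add: real_chain_map_def scale_chain_sum)

lemma real_chain_map_diff:
  "real_chain_map p f (c - d) = real_chain_map p f c - real_chain_map p f d"
  by (simp add: diff_scale_chain real_chain_map_add real_chain_map_scale)

lemma real_chain_map_sum:
  "real_chain_map p f (sum h A) = (\<Sum>i\<in>A. real_chain_map p f (h i))"
  by (induction A rule: infinite_finite_induct) (simp_all add: real_chain_map_add)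

lemma real_chain_map_compose:
  "real_chain_map p (g \<circ> f) c = real_chain_map p g (real_chain_map p f c)"
  by (simp add: real_chain_map_def[of p f] real_chain_map_sum)
     (simp add: real_chain_map_def simplex_map_compose)

lemma real_chain_boundary_map:
  assumes "real_singular_chain p X c"
  shows "real_chain_boundary p (real_chain_map p f c) =
    real_chain_map (p - 1) f (real_chain_boundary p c)"
proof (cases "p = 0")
  case False
  have "singular_face p k (simplex_map p f \<sigma>) = simplex_map (p - 1) f (singular_face p k \<sigma>)"
    if "\<sigma> \<in> Poly_Mapping.keys c" "k \<le> p" for k \<sigma>
    using singular_face_simplex_map[of p k f \<sigma>] that False
    by (simp add: singular_face_def simplex_map_def fun_eq_iff)
  then show ?thesis
    using False
    by (simp add: real_chain_map_def[of p] real_chain_boundary_sum real_chain_boundary_single)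
       (simp add: real_chain_boundary_def real_chain_map_sum)
qed (simp add: real_chain_boundary_def)

lemma real_singular_chain_zero [simp]: "real_singular_chain p X 0"
  by (simp add: real_singular_chain_def)

lemma real_singular_chain_single:
  "singular_simplex p X \<sigma> \<Longrightarrow> real_singular_chain p X (Poly_Mapping.single \<sigma> r)"
  by (auto simp: real_singular_chain_def)

lemma real_singular_chain_add:
  "real_singular_chain p X c \<Longrightarrow> real_singular_chain p X d \<Longrightarrow> real_singular_chain p X (c + d)"
  unfolding real_singular_chain_def using Poly_Mapping.keys_add[of c d] by blast

lemma real_singular_chain_scale:
  "real_singular_chain p X c \<Longrightarrow> real_singular_chain p X (scale_chain a c)"
  unfolding real_singular_chain_def using keys_scale_chain by blast

lemma real_singular_chain_diff:
  "real_singular_chain p X c \<Longrightarrow> real_singular_chain p X d \<Longrightarrow> real_singular_chain p X (c - d)"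
  by (simp add: diff_scale_chain real_singular_chain_add real_singular_chain_scale)

lemma real_singular_chain_sum:
  "(\<And>i. i \<in> A \<Longrightarrow> real_singular_chain p X (h i)) \<Longrightarrow> real_singular_chain p X (sum h A)"
  by (induction A rule: infinite_finite_induct) (simp_all add: real_singular_chain_add)

lemma real_singular_chain_map:
  assumes "real_singular_chain p X c" "continuous_map X Y f"
  shows "real_singular_chain p Y (real_chain_map p f c)"
  unfolding real_chain_map_def using assms
  by (intro real_singular_chain_sum real_singular_chain_single singular_simplex_simplex_map)
     (auto simp: real_singular_chain_def)

lemma l1_norm_nonneg: "0 \<le> l1_norm c"
  by (simp add: l1_norm_def sum_nonneg)

lemma l1_norm_zero [simp]: "l1_norm 0 = 0"
  by (simp add: l1_norm_def)

lemma l1_norm_single [simp]: "l1_norm (Poly_Mapping.single \<sigma> r) = \<bar>r\<bar>"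
  by (simp add: l1_norm_def)

lemma l1_norm_scale: "l1_norm (scale_chain a c) = \<bar>a\<bar> * l1_norm c"
  using sum_keys_superset[OF finite_keys keys_scale_chain, of "\<lambda>_. abs" a c]
  by (simp add: l1_norm_def abs_mult sum_distrib_left)

lemma l1_norm_add: "l1_norm (c + d) \<le> l1_norm c + l1_norm d"
proof -
  let ?A = "Poly_Mapping.keys c \<union> Poly_Mapping.keys d"
  have "Poly_Mapping.keys (c + d) \<subseteq> ?A" by (rule Poly_Mapping.keys_add)
  then show ?thesis
    using sum_keys_superset[of ?A "c + d" "\<lambda>_. abs"] sum_keys_superset[of ?A c "\<lambda>_. abs"]
      sum_keys_superset[of ?A d "\<lambda>_. abs"]
    by (simp add: l1_norm_def lookup_add sum.distrib[symmetric] sum_mono)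
qed

lemma l1_norm_diff: "l1_norm (c - d) \<le> l1_norm c + l1_norm d"
  using l1_norm_add[of c "scale_chain (-1) d"] by (simp add: diff_scale_chain l1_norm_scale)

lemma l1_norm_sum: "l1_norm (sum h A) \<le> (\<Sum>i\<in>A. l1_norm (h i))"
proof (induction A rule: infinite_finite_induct)
  case (insert i A)
  then show ?case using l1_norm_add[of "h i" "sum h A"] by simp
qed simp_all

lemma l1_norm_map: "l1_norm (real_chain_map p f c) \<le> l1_norm c"
  unfolding real_chain_map_def by (rule order_trans[OF l1_norm_sum]) (simp add: l1_norm_def[of c])

section \<open>Affine triangles and tetrahedra\<close>

text \<open>
  The singular 2-simplex and 3-simplex obtained by composing a map \<open>F\<close> of a real vector space with
  the affine simplex that has the given vertices, in that order.
\<close>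

definition triangle :: "('v::real_vector \<Rightarrow> 'a) \<Rightarrow> 'v \<Rightarrow> 'v \<Rightarrow> 'v \<Rightarrow> (nat \<Rightarrow> real) \<Rightarrow> 'a" where
  "triangle F a b c =
     restrict (\<lambda>x. F (x 0 *\<^sub>R a + x 1 *\<^sub>R b + x 2 *\<^sub>R c)) (standard_simplex 2)"

definition tetrahedron ::
  "('v::real_vector \<Rightarrow> 'a) \<Rightarrow> 'v \<Rightarrow> 'v \<Rightarrow> 'v \<Rightarrow> 'v \<Rightarrow> (nat \<Rightarrow> real) \<Rightarrow> 'a" where
  "tetrahedron F a b c d =
     restrict (\<lambda>x. F (x 0 *\<^sub>R a + x 1 *\<^sub>R b + x 2 *\<^sub>R c + x 3 *\<^sub>R d)) (standard_simplex 3)"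

lemma singular_face_tetrahedron:
  "singular_face 3 0 (tetrahedron F a b c d) = triangle F b c d"
  "singular_face 3 1 (tetrahedron F a b c d) = triangle F a c d"
  "singular_face 3 2 (tetrahedron F a b c d) = triangle F a b d"
  "singular_face 3 3 (tetrahedron F a b c d) = triangle F a b c"
proof -
  have "singular_face 3 k (tetrahedron F a b c d) = restrict
      (\<lambda>x. F (simplical_face k x 0 *\<^sub>R a + simplical_face k x 1 *\<^sub>R b +
        simplical_face k x 2 *\<^sub>R c + simplical_face k x 3 *\<^sub>R d)) (standard_simplex 2)"
    if "k \<le> 3" for k
    using simplical_face_in_standard_simplex[of 3 k] that
    by (auto simp: singular_face_def tetrahedron_def simp del: One_nat_def intro!: restrict_ext)
  from this[of 0] this[of 1] this[of 2] this[of 3]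
  show "singular_face 3 0 (tetrahedron F a b c d) = triangle F b c d"
    "singular_face 3 1 (tetrahedron F a b c d) = triangle F a c d"
    "singular_face 3 2 (tetrahedron F a b c d) = triangle F a b d"
    "singular_face 3 3 (tetrahedron F a b c d) = triangle F a b c"
    by (simp_all add: triangle_def simplical_face_def)
qed

lemma real_chain_boundary_tetrahedron:
  "real_chain_boundary 3 (Poly_Mapping.single (tetrahedron F a b c d) 1) =
     Poly_Mapping.single (triangle F b c d) 1 - Poly_Mapping.single (triangle F a c d) 1
     + Poly_Mapping.single (triangle F a b d) 1 - Poly_Mapping.single (triangle F a b c) 1"
proof -
  have "{..3::nat} = {0, 1, 2, 3}" by auto
  then show ?thesis
    using singular_face_tetrahedron[of F a b c d]
    by (simp add: real_chain_boundary_single single_uminus del: One_nat_def)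
qed

lemma standard_simplex_2:
  "x \<in> standard_simplex 2 \<Longrightarrow> 0 \<le> x 0 \<and> 0 \<le> x 1 \<and> 0 \<le> x 2 \<and> x 0 + x 1 + x 2 = 1"
  by (auto simp: standard_simplex_def numeral_2_eq_2)

lemma triangle_eqI:
  assumes "\<And>r s t. 0 \<le> r \<Longrightarrow> 0 \<le> s \<Longrightarrow> 0 \<le> t \<Longrightarrow> r + s + t = 1 \<Longrightarrow>
    F (r *\<^sub>R a + s *\<^sub>R b + t *\<^sub>R c) = G (r *\<^sub>R a' + s *\<^sub>R b' + t *\<^sub>R c')"
  shows "triangle F a b c = triangle G a' b' c'"
  unfolding triangle_def
  by (rule restrict_ext) (use standard_simplex_2 assms in blast)

lemma simplex_map_triangle: "simplex_map 2 g (triangle F a b c) = triangle (g \<circ> F) a b c"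
  by (auto simp: simplex_map_def triangle_def)

lemma singular_simplex_tetrahedron:
  fixes F :: "'v::real_normed_vector \<Rightarrow> 'a"
  assumes F: "continuous_map (top_of_set C) X F"
    and C: "convex C" "a \<in> C" "b \<in> C" "c \<in> C" "d \<in> C"
  shows "singular_simplex 3 X (tetrahedron F a b c d)"
proof -
  let ?L = "\<lambda>x::nat \<Rightarrow> real. x 0 *\<^sub>R a + x 1 *\<^sub>R b + x 2 *\<^sub>R c + x 3 *\<^sub>R d"
  have p: "continuous_on A (\<lambda>x::nat \<Rightarrow> real. x i)" for A i
    by (rule continuous_on_subset[OF continuous_on_product_coordinates]) simp
  have "?L x \<in> C" if "x \<in> standard_simplex 3" for x
  proof -
    have x: "0 \<le> x i" for i using that by (simp add: standard_simplex_def)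
    have "(\<Sum>i\<le>3. x i) = 1" using that by (simp add: standard_simplex_def)
    then have s: "(\<Sum>i\<in>{0,1,2,3}. x i) = 1"
      by (simp add: numeral_eq_Suc add.assoc)
    have "(\<Sum>i\<in>{0,1,2,3}. x i *\<^sub>R ([a,b,c,d] ! i)) \<in> C"
      by (rule convex_sum[OF _ C(1) s]) (use C x in \<open>auto simp: numeral_eq_Suc\<close>)
    then show ?thesis by (simp add: numeral_eq_Suc add.assoc)
  qed
  moreover have "continuous_on (standard_simplex 3) ?L"
    by (intro continuous_intros p)
  ultimately have "continuous_map (top_of_set (standard_simplex 3)) (top_of_set C) ?L"
    by (auto simp: continuous_map_in_subtopology)
  then have "continuous_map (top_of_set (standard_simplex 3)) X (F \<circ> ?L)"
    using F by (rule continuous_map_compose)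
  then show ?thesis
    unfolding singular_simplex_def tetrahedron_def
    by (auto simp: euclidean_product_topology o_def intro: continuous_map_eq)
qed

section \<open>Doubling the torus\<close>

text \<open>
  The universal covering of the torus, with deck group \<open>\<int> \<times> \<int>\<close>.
\<close>

definition wrap :: "real \<times> real \<Rightarrow> complex \<times> complex" where
  "wrap v = (cis (2 * pi * fst v), cis (2 * pi * snd v))"

text \<open>
  Multiplication by 2 on the torus, written multiplicatively; a covering of degree 4.
\<close>

definition double_torus :: "complex \<times> complex \<Rightarrow> complex \<times> complex" where
  "double_torus z = (fst z ^ 2, snd z ^ 2)"

lemma wrap_in_torus: "wrap v \<in> torus"
  by (simp add: wrap_def torus_def)

lemma continuous_on_wrap: "continuous_on A wrap"
  unfolding wrap_def by (intro continuous_on_Pair continuous_on_cis continuous_intros)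

lemma continuous_map_wrap: "continuous_map (top_of_set A) (top_of_set torus) wrap"
  using continuous_on_wrap wrap_in_torus by (auto simp: continuous_map_in_subtopology)

lemma double_torus_wrap: "double_torus (wrap v) = wrap (2 *\<^sub>R v)"
  by (simp add: double_torus_def wrap_def DeMoivre mult_ac)

lemma continuous_map_double_torus:
  "continuous_map (top_of_set torus) (top_of_set torus) double_torus"
proof -
  have "continuous_on torus double_torus"
    unfolding double_torus_def by (intro continuous_intros)
  moreover have "double_torus ` torus \<subseteq> torus"
    by (auto simp: double_torus_def torus_def norm_power)
  ultimately show ?thesis by (auto simp: continuous_map_in_subtopology)
qed

lemma torus_loops_wrap: "torus_loop1 t = wrap (t, 0)" "torus_loop2 t = wrap (0, t)"
  by (simp_all add: torus_loop1_def torus_loop2_def wrap_def)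

lemma torus_simplices_triangle:
  "torus_simplex1 = triangle wrap 0 (1, 0) (1, 1)"
  "torus_simplex2 = triangle wrap 0 (0, 1) (1, 1)"
  by (simp_all add: torus_simplex1_def torus_simplex2_def triangle_def wrap_def)

text \<open>
  The deck group of the covering.
\<close>

definition lattice :: "(real \<times> real) set" where
  "lattice = \<int> \<times> \<int>"

lemma wrap_add_lattice: "a \<in> lattice \<Longrightarrow> wrap (v + a) = wrap v"
  by (auto simp: lattice_def wrap_def distrib_left cis_mult[symmetric] elim!: Ints_cases)

text \<open>
  The bar cells \<open>[a|b]\<close> and \<open>[a|b|c]\<close> of the lattice, realized on the torus by the affine simplices
  with vertices \<open>0, a, a + b\<close> and \<open>0, a, a + b, a + b + c\<close>. The boundary formula of the bar complex
  needs only the first entry to be a lattice vector, since only the face opposite to \<open>0\<close> has to be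
  translated.
\<close>

definition bar2 :: "real \<times> real \<Rightarrow> real \<times> real \<Rightarrow> (complex \<times> complex) real_chain" where
  "bar2 a b = Poly_Mapping.single (triangle wrap 0 a (a + b)) 1"

definition bar3 :: "real \<times> real \<Rightarrow> real \<times> real \<Rightarrow> real \<times> real \<Rightarrow> (complex \<times> complex) real_chain" where
  "bar3 a b c = Poly_Mapping.single (tetrahedron wrap 0 a (a + b) (a + b + c)) 1"

lemma boundary_bar3:
  assumes "a \<in> lattice"
  shows "real_chain_boundary 3 (bar3 a b c) = bar2 b c - bar2 (a + b) c + bar2 a (b + c) - bar2 a b"
proof -
  have "triangle wrap a (a + b) (a + b + c) = triangle wrap 0 b (b + c)"
  proof (rule triangle_eqI)
    fix r s t :: real
    assume "r + s + t = 1"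
    then have "r *\<^sub>R a + s *\<^sub>R a + t *\<^sub>R a = a"
      by (metis scaleR_add_left scaleR_one)
    then have "r *\<^sub>R a + s *\<^sub>R (a + b) + t *\<^sub>R (a + b + c) =
      (r *\<^sub>R 0 + s *\<^sub>R b + t *\<^sub>R (b + c)) + a"
      by (simp add: algebra_simps)
    then show "wrap (r *\<^sub>R a + s *\<^sub>R (a + b) + t *\<^sub>R (a + b + c)) =
      wrap (r *\<^sub>R 0 + s *\<^sub>R b + t *\<^sub>R (b + c))"
      using wrap_add_lattice[OF assms] by simp
  qed
  then show ?thesis
    by (simp add: bar3_def bar2_def real_chain_boundary_tetrahedron add.assoc)
qed

lemma real_singular_chain_bar3: "real_singular_chain 3 (top_of_set torus) (bar3 a b c)"
  unfolding bar3_def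
  by (intro real_singular_chain_single singular_simplex_tetrahedron[where C = UNIV]
      continuous_map_wrap) auto

text \<open>
  The 2-cycle \<open>[a|b] - [b|a]\<close> of the commuting pair \<open>a, b\<close>.
\<close>

definition lattice_torus :: "real \<times> real \<Rightarrow> real \<times> real \<Rightarrow> (complex \<times> complex) real_chain" where
  "lattice_torus a b = bar2 a b - bar2 b a"

text \<open>
  The shuffle product of \<open>[a|a']\<close> with \<open>[b]\<close>. Its boundary witnesses that the homology class of
  \<open>[a|b] - [b|a]\<close> is additive in \<open>a\<close>.
\<close>

definition shuffle :: "real \<times> real \<Rightarrow> real \<times> real \<Rightarrow> real \<times> real \<Rightarrow> (complex \<times> complex) real_chain" where
  "shuffle a a' b = bar3 a a' b - bar3 a b a' + bar3 b a a'"

lemma lattice_torus_add: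
  assumes "a \<in> lattice" "b \<in> lattice"
  shows "lattice_torus (a + a') b =
    lattice_torus a b + lattice_torus a' b - real_chain_boundary 3 (shuffle a a' b)"
  using assms
  by (simp add: lattice_torus_def shuffle_def boundary_bar3 real_chain_boundary_add
      real_chain_boundary_diff add.commute[of b a] add.commute[of b a'])

lemma torus_cycle_lattice_torus: "torus_cycle = lattice_torus (1, 0) (0, 1)"
  by (simp add: torus_cycle_def torus_simplices_triangle lattice_torus_def bar2_def)

lemma map_double_lattice_torus:
  "real_chain_map 2 double_torus (lattice_torus a b) = lattice_torus (a + a) (b + b)"
proof -
  have "triangle (double_torus \<circ> wrap) 0 a (a + b) = triangle wrap 0 (a + a) (a + a + (b + b))" for a b
    by (rule triangle_eqI)
      (simp add: double_torus_wrap scaleR_2 scaleR_add_right add_ac del: scaleR_scaleR)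
  then show ?thesis
    by (simp add: lattice_torus_def bar2_def real_chain_map_diff simplex_map_triangle)
qed

text \<open>
  Doubling has degree 4: by bilinearity, the cycle of \<open>(2a, 2b)\<close> is homologous to four times the
  cycle of \<open>(a, b)\<close>.
\<close>

lemma double_torus_cycle_homologous:
  obtains w where "real_singular_chain 3 (top_of_set torus) w"
    "real_chain_map 2 double_torus torus_cycle = scale_chain 4 torus_cycle + real_chain_boundary 3 w"
proof -
  let ?a = "(1, 0) :: real \<times> real" and ?b = "(0, 1) :: real \<times> real"
  define v where "v = shuffle ?b ?b ?a"
  define v' where "v' = shuffle ?a ?a (?b + ?b)"
  have L: "?a \<in> lattice" "?b \<in> lattice" "?b + ?b \<in> lattice"
    by (auto simp: lattice_def)
  have anti: "lattice_torus x y = - lattice_torus y x" for x y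
    by (simp add: lattice_torus_def)
  have "lattice_torus ?a (?b + ?b) =
      lattice_torus ?a ?b + lattice_torus ?a ?b + real_chain_boundary 3 v"
    using lattice_torus_add[OF L(2,1), of ?b] anti[of ?a ?b] anti[of ?a "?b + ?b"]
    by (simp add: v_def)
  then have *: "lattice_torus (?a + ?a) (?b + ?b) =
      (lattice_torus ?a ?b + lattice_torus ?a ?b + real_chain_boundary 3 v)
      + (lattice_torus ?a ?b + lattice_torus ?a ?b + real_chain_boundary 3 v)
      - real_chain_boundary 3 v'"
    using lattice_torus_add[OF L(1,3), of ?a] by (simp add: v'_def)
  have four: "scale_chain 4 x = x + x + (x + x)" for x :: "(complex \<times> complex) real_chain"
    by (rule poly_mapping_eqI) (simp add: lookup_add)
  have "real_singular_chain 3 (top_of_set torus) (v + v - v')"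
    unfolding v_def v'_def shuffle_def
    by (intro real_singular_chain_add real_singular_chain_diff real_singular_chain_bar3)
  moreover have "real_chain_map 2 double_torus torus_cycle =
      scale_chain 4 torus_cycle + real_chain_boundary 3 (v + v - v')"
    unfolding torus_cycle_lattice_torus map_double_lattice_torus * four
    by (simp add: real_chain_boundary_add real_chain_boundary_diff)
  ultimately show thesis by (rule that)
qed

lemma represents_torus_class_torus_cycle: "represents_torus_class torus_cycle"
  unfolding represents_torus_class_def
proof (intro conjI exI[of _ 0])
  show "real_singular_chain 2 (top_of_set torus) torus_cycle"
    unfolding torus_cycle_def
    by (intro real_singular_chain_diff real_singular_chain_single singular_simplex_torus)
qed (simp_all add: torus_cycle_boundary)

text \<open>
  Doubling followed by division by its degree preserves the fundamental class and, as push-forward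
  does not increase the norm, reduces the norm at least by the factor 4.
\<close>

definition shrink :: "(complex \<times> complex) real_chain \<Rightarrow> (complex \<times> complex) real_chain" where
  "shrink x = scale_chain (1/4) (real_chain_map 2 double_torus x)"

lemma l1_norm_shrink: "l1_norm (shrink x) \<le> l1_norm x / 4"
  using l1_norm_map[of 2 double_torus x] by (simp add: shrink_def l1_norm_scale)

lemma represents_torus_class_shrink:
  assumes "represents_torus_class x"
  shows "represents_torus_class (shrink x)"
proof -
  let ?T = "top_of_set torus"
  from assms obtain v where x: "real_singular_chain 2 ?T x" "real_chain_boundary 2 x = 0"
    and v: "real_singular_chain 3 ?T v" "x - torus_cycle = real_chain_boundary 3 v"
    by (auto simp: represents_torus_class_def)
  obtain w where w: "real_singular_chain 3 ?T w"
    "real_chain_map 2 double_torus torus_cycle = scale_chain 4 torus_cycle + real_chain_boundary 3 w"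
    by (rule double_torus_cycle_homologous)
  define u where "u = scale_chain (1/4) (real_chain_map 3 double_torus v + w)"
  have "real_singular_chain 2 ?T (shrink x)"
    unfolding shrink_def
    by (intro real_singular_chain_scale real_singular_chain_map[OF x(1)] continuous_map_double_torus)
  moreover have "real_chain_boundary 2 (shrink x) = 0"
    by (simp add: shrink_def real_chain_boundary_scale real_chain_boundary_map[OF x(1)] x(2)
        scale_chain_eqs)
  moreover have "real_singular_chain 3 ?T u"
    unfolding u_def
    by (intro real_singular_chain_scale real_singular_chain_add w(1) real_singular_chain_map[OF v(1)]
        continuous_map_double_torus)
  moreover have "shrink x - torus_cycle = real_chain_boundary 3 u"
  proof -
    have "x = torus_cycle + real_chain_boundary 3 v" using v(2) by (simp add: algebra_simps)
    then have "real_chain_map 2 double_torus x = scale_chain 4 torus_cycle + real_chain_boundary 3 w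
        + real_chain_boundary 3 (real_chain_map 3 double_torus v)"
      by (simp add: real_chain_map_add w(2) real_chain_boundary_map[OF v(1)])
    then show ?thesis
      by (simp add: shrink_def u_def scale_chain_eqs real_chain_boundary_scale
          real_chain_boundary_add)
  qed
  ultimately show ?thesis by (auto simp: represents_torus_class_def)
qed

lemma small_torus_cycles_shrink:
  "(shrink ^^ m) torus_cycle \<in> small_torus_cycles (2 / 4 ^ m)"
proof (induction m)
  case 0
  have "l1_norm torus_cycle \<le> 2"
    unfolding torus_cycle_def by (rule order_trans[OF l1_norm_diff]) simp
  then show ?case
    by (simp add: small_torus_cycles_def represents_torus_class_torus_cycle)
next
  case (Suc m)
  then show ?case
    using l1_norm_shrink[of "(shrink ^^ m) torus_cycle"]
    by (simp add: small_torus_cycles_def represents_torus_class_shrink)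
qed

section \<open>Extension over squares and cubes\<close>

text \<open>
  A continuous surjection from a compact space onto a metric space is a quotient map, so continuous
  maps that are constant on its fibres descend.
\<close>

lemma compact_quotient_lift:
  fixes q :: "'a::topological_space \<Rightarrow> 'c::metric_space"
  assumes "compact A" "continuous_on A q" "q ` A = C"
    and h: "continuous_map (top_of_set A) X h"
    and fibres: "\<And>x y. x \<in> A \<Longrightarrow> y \<in> A \<Longrightarrow> q x = q y \<Longrightarrow> h x = h y"
  shows "\<exists>g. continuous_map (top_of_set C) X g \<and> (\<forall>x\<in>A. g (q x) = h x)"
proof -
  have "quotient_map (top_of_set A) (top_of_set C) q"
    using assms(1-3)
    by (intro continuous_imp_quotient_map)
      (auto simp: continuous_map_in_subtopology Hausdorff_space_subtopology compact_space_subtopology)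
  from quotient_map_lift_exists[OF this h] fibres show ?thesis
    by (metis topspace_euclidean_subtopology)
qed

text \<open>
  The cube \<open>[0,1]\<^sup>3\<close>. The distance of a point from the centre \<open>(1/2, 1/2, 1/2)\<close> in the maximum norm,
  multiplied by 2, is its \<open>radius\<close>, and \<open>dilate\<close> is scaling about the centre; thus the cube is
  given by \<open>radius \<le> 1\<close> and its boundary by \<open>radius = 1\<close>.
\<close>

definition cube :: "(real \<times> real \<times> real) set" where
  "cube = {0..1} \<times> {0..1} \<times> {0..1}"

definition radius :: "real \<times> real \<times> real \<Rightarrow> real" where
  "radius v = 2 * max \<bar>fst v - 1/2\<bar> (max \<bar>fst (snd v) - 1/2\<bar> \<bar>snd (snd v) - 1/2\<bar>)"

definition dilate :: "real \<Rightarrow> real \<times> real \<times> real \<Rightarrow> real \<times> real \<times> real" where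
  "dilate r v = (1/2, 1/2, 1/2) + r *\<^sub>R (v - (1/2, 1/2, 1/2))"

lemma mem_cube_iff: "v \<in> cube \<longleftrightarrow> radius v \<le> 1"
proof -
  have "radius (a, b, c) \<le> 1 \<longleftrightarrow> 0 \<le> a \<and> a \<le> 1 \<and> 0 \<le> b \<and> b \<le> 1 \<and> 0 \<le> c \<and> c \<le> 1" for a b c
    unfolding radius_def fst_conv snd_conv max_def by argo
  then show ?thesis by (cases v) (auto simp: cube_def)
qed

definition cube_boundary :: "(real \<times> real \<times> real) set" where
  "cube_boundary = {v. radius v = 1}"

lemma cube_boundary_faces:
  "cube_boundary = {0..1} \<times> {0..1} \<times> {0,1} \<union> ({0,1} \<times> {0..1} \<times> {0..1} \<union> {0..1} \<times> {0,1} \<times> {0..1})"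
proof -
  have "radius (a, b, c) = 1 \<longleftrightarrow> 0 \<le> a \<and> a \<le> 1 \<and> 0 \<le> b \<and> b \<le> 1 \<and> 0 \<le> c \<and> c \<le> 1 \<and>
      (a = 0 \<or> a = 1 \<or> b = 0 \<or> b = 1 \<or> c = 0 \<or> c = 1)" for a b c
    unfolding radius_def fst_conv snd_conv max_def by argo
  then show ?thesis by (auto simp: cube_boundary_def)
qed

lemma radius_nonneg: "0 \<le> radius v"
  by (simp add: radius_def max_def)

lemma radius_dilate: "radius (dilate r v) = \<bar>r\<bar> * radius v"
  by (simp add: radius_def dilate_def abs_mult max_mult_distrib_left mult.left_commute)

lemma dilate_dilate: "dilate r (dilate s v) = dilate (r * s) v"
  by (simp add: dilate_def)

lemma dilate_1 [simp]: "dilate 1 v = v"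
  by (simp add: dilate_def)

lemma continuous_on_radius: "continuous_on A radius"
  unfolding radius_def by (intro continuous_intros)

lemma nsphere_2_projection:
  "continuous_map (nsphere 2) (top_of_set cube_boundary)
     (\<lambda>x. dilate (1 / radius ((1/2, 1/2, 1/2) + (x 0, x 1, x 2)))
       ((1/2, 1/2, 1/2) + (x 0, x 1, x 2)))"
  (is "continuous_map _ _ ?f")
proof -
  let ?v = "\<lambda>x::nat \<Rightarrow> real. (1/2, 1/2, 1/2) + (x 0, x 1, x 2)"
  have pos: "radius (?v x) \<noteq> 0" if "x \<in> topspace (nsphere 2)" for x
  proof
    assume "radius (?v x) = 0"
    then have "x 0 = 0" "x 1 = 0" "x 2 = 0"
      by (auto simp: radius_def max_def split: if_splits)
    then have "(\<Sum>i\<le>2. (x i)\<^sup>2) = 0" by (simp add: numeral_2_eq_2)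
    then show False using that by (simp add: nsphere)
  qed
  have top: "nsphere 2 = top_of_set (topspace (nsphere 2))"
    by (simp add: nsphere euclidean_product_topology)
  have p: "continuous_on A (\<lambda>x::nat \<Rightarrow> real. x i)" for A i
    by (rule continuous_on_subset[OF continuous_on_product_coordinates]) simp
  have "continuous_on (topspace (nsphere 2)) (\<lambda>x. radius (?v x))"
    unfolding radius_def by (intro continuous_intros p)
  then have "continuous_on (topspace (nsphere 2)) ?f"
    unfolding dilate_def using pos by (intro continuous_intros p) auto
  moreover have "?f x \<in> cube_boundary" if "x \<in> topspace (nsphere 2)" for x
    using pos[OF that] radius_nonneg[of "?v x"] by (simp add: cube_boundary_def radius_dilate)
  ultimately show ?thesis
    by (subst top) (auto simp: continuous_map_in_subtopology)
qed

text \<open>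
  Radial projections between the boundary of the cube and the round sphere.
\<close>

lemma cube_boundary_to_nsphere:
  obtains \<nu> \<pi> where
    "continuous_map (top_of_set cube_boundary) (nsphere 2) \<nu>"
    "continuous_map (nsphere 2) (top_of_set cube_boundary) \<pi>"
    "\<And>b. b \<in> cube_boundary \<Longrightarrow> \<pi> (\<nu> b) = b"
proof -
  let ?h = "(1/2, 1/2, 1/2) :: real \<times> real \<times> real"
  let ?v = "\<lambda>x::nat \<Rightarrow> real. ?h + (x 0, x 1, x 2)"
  let ?\<pi> = "\<lambda>x::nat \<Rightarrow> real. dilate (1 / radius (?v x)) (?v x)"
  let ?c = "\<lambda>b (i::nat). if i = 0 then fst b - 1/2 else if i = 1 then fst (snd b) - 1/2
    else if i = 2 then snd (snd b) - 1/2 else (0::real)"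
  let ?n = "\<lambda>b. sqrt ((fst b - 1/2)\<^sup>2 + (fst (snd b) - 1/2)\<^sup>2 + (snd (snd b) - 1/2)\<^sup>2)"
  let ?\<nu> = "\<lambda>b i. ?c b i / ?n b"
  have pos: "0 < ?n b" if "b \<in> cube_boundary" for b
  proof (rule ccontr)
    assume "\<not> 0 < ?n b"
    then have "(fst b - 1/2)\<^sup>2 + (fst (snd b) - 1/2)\<^sup>2 + (snd (snd b) - 1/2)\<^sup>2 \<le> 0"
      by simp
    then have "(fst b - 1/2)\<^sup>2 = 0 \<and> (fst (snd b) - 1/2)\<^sup>2 = 0 \<and> (snd (snd b) - 1/2)\<^sup>2 = 0"
      using zero_le_power2[of "fst b - 1/2"] zero_le_power2[of "fst (snd b) - 1/2"]
        zero_le_power2[of "snd (snd b) - 1/2"] by linarith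
    then have "radius b = 0" by (simp add: radius_def)
    then show False using that by (simp add: cube_boundary_def)
  qed
  have sq: "(\<Sum>i\<le>2. (?\<nu> b i)\<^sup>2) = 1" if "b \<in> cube_boundary" for b
    using pos[OF that]
    by (simp add: numeral_2_eq_2 power_divide add_divide_distrib[symmetric])
  have "continuous_on cube_boundary (\<lambda>b. ?\<nu> b i)" for i
  proof -
    have "continuous_on cube_boundary (\<lambda>b. ?c b i)"
      by (cases "i = 0"; cases "i = 1"; cases "i = 2") (auto intro!: continuous_intros)
    then show ?thesis
      using pos by (intro continuous_intros) (auto simp: less_le)
  qed
  then have "continuous_map (top_of_set cube_boundary) (nsphere 2) ?\<nu>"
    using sq by (auto simp: nsphere continuous_map_in_subtopology continuous_map_componentwise_UNIV)
  moreover have "?\<pi> (?\<nu> b) = b" if "b \<in> cube_boundary" for b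
  proof -
    have "?v (?\<nu> b) = dilate (1 / ?n b) b"
      by (cases b) (simp add: dilate_def)
    then show ?thesis
      using pos[OF that] that
      by (simp add: radius_dilate dilate_dilate cube_boundary_def less_le)
  qed
  ultimately show thesis using nsphere_2_projection that by blast
qed

text \<open>
  A null-homotopic map on the boundary extends over the cube, which is the quotient of the cylinder
  over its boundary by the collapse of one end. The null-homotopy is given for spheres and
  transported along the radial projections.
\<close>

lemma extend_over_cube:
  assumes sphere: "\<And>s. continuous_map (nsphere 2) X s \<Longrightarrow>
      \<exists>c. homotopic_with (\<lambda>_. True) (nsphere 2) X s (\<lambda>_. c)"
    and B: "continuous_map (top_of_set cube_boundary) X B"
  obtains F where "continuous_map (top_of_set cube) X F" "\<And>b. b \<in> cube_boundary \<Longrightarrow> F b = B b"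
proof -
  obtain \<nu> \<pi> where \<nu>: "continuous_map (top_of_set cube_boundary) (nsphere 2) \<nu>"
    and \<pi>: "continuous_map (nsphere 2) (top_of_set cube_boundary) \<pi>"
    and \<pi>\<nu>: "\<And>b. b \<in> cube_boundary \<Longrightarrow> \<pi> (\<nu> b) = b"
    by (rule cube_boundary_to_nsphere) blast
  obtain c where "homotopic_with (\<lambda>_. True) (nsphere 2) X (B \<circ> \<pi>) (\<lambda>_. c)"
    using sphere[OF continuous_map_compose[OF \<pi> B]] by blast
  then have "homotopic_with (\<lambda>_. True) (nsphere 2) X (\<lambda>_. c) (B \<circ> \<pi>)"
    by (rule homotopic_with_symD)
  from homotopic_with_compose_continuous_map_right[OF this \<nu>, of "\<lambda>_. True"]
  have "homotopic_with (\<lambda>_. True) (top_of_set cube_boundary) X ((\<lambda>_. c) \<circ> \<nu>) (B \<circ> \<pi> \<circ> \<nu>)"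
    by simp
  then obtain H where H: "continuous_map (prod_topology (top_of_set {0..1::real}) (top_of_set cube_boundary)) X H"
    and H0: "\<And>b. H (0, b) = c" and H1: "\<And>b. H (1, b) = B (\<pi> (\<nu> b))"
    by (auto simp: homotopic_with_def)
  let ?A = "{0..1::real} \<times> cube_boundary"
  let ?q = "\<lambda>p. dilate (fst p) (snd p)"
  have "bounded cube_boundary"
    by (rule bounded_subset[OF compact_imp_bounded[of "{0..1} \<times> {0..1} \<times> {0..1}"]])
      (auto simp: cube_boundary_faces intro!: compact_Times)
  moreover have "closed cube_boundary"
    unfolding cube_boundary_faces by (intro closed_Un closed_Times) auto
  ultimately have "compact cube_boundary" by (simp add: compact_eq_bounded_closed)
  then have "compact ?A" by (intro compact_Times compact_Icc)
  moreover have "continuous_on ?A ?q"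
    unfolding dilate_def by (intro continuous_intros)
  moreover have "?q ` ?A = cube"
  proof (intro equalityI subsetI)
    fix v assume "v \<in> ?q ` ?A"
    then show "v \<in> cube"
      by (auto simp: mem_cube_iff radius_dilate cube_boundary_def)
  next
    fix v assume v: "v \<in> cube"
    show "v \<in> ?q ` ?A"
    proof (cases "radius v = 0")
      case True
      then have "v = (1/2, 1/2, 1/2)"
        by (cases v) (auto simp: radius_def max_def split: if_splits)
      then have "v = ?q (0, (0, 0, 0))" by (simp add: dilate_def)
      moreover have "(0, (0, 0, 0)) \<in> ?A" by (simp add: cube_boundary_def radius_def)
      ultimately show ?thesis by blast
    next
      case False
      then have "v = ?q (radius v, dilate (1 / radius v) v)"
        by (simp add: dilate_dilate)
      moreover have "(radius v, dilate (1 / radius v) v) \<in> ?A"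
        using False radius_nonneg[of v] v
        by (simp add: cube_boundary_def radius_dilate mem_cube_iff)
      ultimately show ?thesis by blast
    qed
  qed
  moreover have "continuous_map (top_of_set ?A) X H"
    using H by (simp add: subtopology_Times euclidean_product_topology)
  moreover have "H x = H y" if x: "x \<in> ?A" and y: "y \<in> ?A" and eq: "?q x = ?q y" for x y
  proof -
    obtain r b s d where xy: "x = (r, b)" "y = (s, d)" by (cases x, cases y)
    have "r = s"
      using arg_cong[OF eq, of radius] x y xy by (simp add: radius_dilate cube_boundary_def)
    moreover have "b = d" if "r \<noteq> 0"
      using eq xy that \<open>r = s\<close> by (simp add: dilate_def)
    ultimately show ?thesis using xy H0 by (cases "r = 0") auto
  qed
  ultimately have "\<exists>F. continuous_map (top_of_set cube) X F \<and> (\<forall>p\<in>?A. F (?q p) = H p)"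
    by (rule compact_quotient_lift)
  then obtain F where F: "continuous_map (top_of_set cube) X F"
    "\<And>p. p \<in> ?A \<Longrightarrow> F (?q p) = H p"
    by blast
  have "F b = B b" if "b \<in> cube_boundary" for b
    using F(2)[of "(1, b)"] that H1 \<pi>\<nu> by simp
  with F(1) show thesis by (rule that)
qed

text \<open>
  A path homotopy from \<open>g +++ p\<close> to \<open>q +++ g\<close> can be reshaped into a square with bottom \<open>q\<close>,
  top \<open>p\<close> and both vertical sides \<open>g\<close>.
\<close>

lemma square_of_homotopic_joins:
  assumes hom: "homotopic_paths S (g +++ p) (q +++ g)"
    and ends: "pathfinish g = pathstart p" "pathfinish q = pathstart g"
  obtains K where "continuous_map (top_of_set ({0..1} \<times> {0..1})) (top_of_set S) K"
    "\<And>s. s \<in> {0..1} \<Longrightarrow> K (s, 0) = q s" "\<And>s. s \<in> {0..1} \<Longrightarrow> K (s, 1) = p s"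
    "\<And>u. u \<in> {0..1} \<Longrightarrow> K (0, u) = g u" "\<And>u. u \<in> {0..1} \<Longrightarrow> K (1, u) = g u"
proof -
  let ?Q = "{0..1::real} \<times> {0..1::real}"
  obtain h where h: "continuous_on ?Q h" "h \<in> ?Q \<rightarrow> S"
    and h0: "\<And>t. t \<in> {0..1} \<Longrightarrow> h (0, t) = (g +++ p) t"
    and h1: "\<And>t. t \<in> {0..1} \<Longrightarrow> h (1, t) = (q +++ g) t"
    and hs: "\<And>v. v \<in> {0..1} \<Longrightarrow> h (v, 0) = pathstart (g +++ p)"
    and hf: "\<And>v. v \<in> {0..1} \<Longrightarrow> h (v, 1) = pathfinish (g +++ p)"
    using hom unfolding homotopic_paths by (auto simp: pathstart_def pathfinish_def)
  define M :: "real \<Rightarrow> real" where "M = (\<lambda>t. min 1 (2 * t))"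
  define N :: "real \<Rightarrow> real" where "N = (\<lambda>t. max 0 (2 * t - 1))"
  \<comment> \<open>\<open>(N t, M t)\<close> runs along the left and top sides of the square and \<open>(M t, N t)\<close> along the bottom and
    right sides. The quotient map \<open>?q\<close> interpolates linearly between these two points; it collapses
    only the edges \<open>t = 0\<close> and \<open>t = 1\<close>, on which \<open>h\<close> is constant.\<close>
  let ?e = "\<lambda>x. (1 - fst x) * N (snd x) + fst x * M (snd x)"
  let ?e' = "\<lambda>x. (1 - fst x) * M (snd x) + fst x * N (snd x)"
  let ?q = "\<lambda>x. (?e x, ?e' x)"
  have MN: "M t + N t = 2 * t" for t by (simp add: M_def N_def)
  have M: "M t \<in> {0..1}" and N: "N t \<in> {0..1}" if "t \<in> {0..1}" for t
    using that by (auto simp: M_def N_def)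
  have sum: "?e x + ?e' x = 2 * snd x" for x
    using MN[of "snd x"] by (simp add: algebra_simps)
  have diff: "?e x - ?e' x = (2 * fst x - 1) * (M (snd x) - N (snd x))" for x
    by (simp add: algebra_simps)
  have conv: "(1 - v) * a + v * b \<in> {0..1}" if "v \<in> {0..1}" "a \<in> {0..1}" "b \<in> {0..1}" for v a b :: real
    using convexD[OF convex_real_interval(5)[of 0 1], of a b "1 - v" v] that by simp
  have "compact ?Q" by (intro compact_Times) auto
  moreover have "continuous_on ?Q ?q"
    unfolding M_def N_def by (intro continuous_intros)
  moreover have "?q ` ?Q = ?Q"
  proof (intro equalityI subsetI)
    fix x assume "x \<in> ?q ` ?Q"
    then show "x \<in> ?Q" using conv M N by auto
  next
    fix x assume x: "x \<in> ?Q"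
    obtain s u where su: "x = (s, u)" by fastforce
    define t where "t = (s + u) / 2"
    define d where "d = M t - N t"
    have t: "t \<in> {0..1}" using x su by (auto simp: t_def)
    have sud: "\<bar>s - u\<bar> \<le> d"
      using x su by (auto simp: d_def M_def N_def t_def min_def max_def abs_if field_simps)
    define v where "v = (if d = 0 then 0 else (1 + (s - u) / d) / 2)"
    have "- 1 \<le> (s - u) / d" "(s - u) / d \<le> 1" if "d \<noteq> 0"
      using sud that by (auto simp: abs_le_iff field_simps)
    then have v: "v \<in> {0..1}" by (auto simp: v_def)
    have "(2 * v - 1) * d = s - u" using sud by (auto simp: v_def field_simps)
    then have "?e (v, t) - ?e' (v, t) = s - u"
      using diff[of "(v, t)"] by (simp add: d_def)
    moreover have "?e (v, t) + ?e' (v, t) = s + u" using sum[of "(v, t)"] by (simp add: t_def)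
    ultimately have "?q (v, t) = x" using su by simp
    then show "x \<in> ?q ` ?Q" using v t by (metis (no_types, lifting) SigmaI image_eqI)
  qed
  moreover have "continuous_map (top_of_set ?Q) (top_of_set S) h"
    using h by (auto simp: continuous_map_in_subtopology)
  moreover have "h x = h y" if x: "x \<in> ?Q" and y: "y \<in> ?Q" and eq: "?q x = ?q y" for x y
  proof -
    have t: "snd x = snd y" using sum[of x] sum[of y] eq by simp
    consider "snd x = 0" | "snd x = 1" | "0 < snd x" "snd x < 1" using x by force
    then show ?thesis
    proof cases
      case 1
      then show ?thesis using hs[of "fst x"] hs[of "fst y"] x y t
        by (metis mem_Times_iff prod.collapse)
    next
      case 2
      then show ?thesis using hf[of "fst x"] hf[of "fst y"] x y t
        by (metis mem_Times_iff prod.collapse)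
    next
      case 3
      then have "M (snd x) - N (snd x) \<noteq> 0" by (auto simp: M_def N_def)
      moreover have "?e x - ?e' x = ?e y - ?e' y" using eq by (simp only: prod.inject)
      then have "(2 * fst x - 1) * (M (snd x) - N (snd x)) = (2 * fst y - 1) * (M (snd y) - N (snd y))"
        by (simp only: diff)
      ultimately have "fst x = fst y" using t by simp
      then show ?thesis using t by (metis prod_eqI)
    qed
  qed
  ultimately have "\<exists>K. continuous_map (top_of_set ?Q) (top_of_set S) K \<and> (\<forall>x\<in>?Q. K (?q x) = h x)"
    by (rule compact_quotient_lift)
  then obtain K where K: "continuous_map (top_of_set ?Q) (top_of_set S) K"
    and Kq: "\<And>x. x \<in> ?Q \<Longrightarrow> K (?q x) = h x"
    by blast
  have ge: "g 1 = p 0" "q 1 = g 0" using ends by (simp_all add: pathstart_def pathfinish_def)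
  show thesis
  proof (rule that[OF K])
    fix s :: real assume s: "s \<in> {0..1}"
    have double: "2 * ((1 + s) / 2) = 1 + s" "(2 + 2 * s) / 2 = 1 + s" by simp_all
    show "K (s, 0) = q s"
      using Kq[of "(1, s / 2)"] h1[of "s / 2"] s by (simp add: M_def N_def joinpaths_def)
    show "K (s, 1) = p s"
      using Kq[of "(0, (1 + s) / 2)"] h0[of "(1 + s) / 2"] s ge
      by (auto simp: M_def N_def joinpaths_def max_def double)
    show "K (0, s) = g s"
      using Kq[of "(0, s / 2)"] h0[of "s / 2"] s by (simp add: M_def N_def joinpaths_def)
    show "K (1, s) = g s"
      using Kq[of "(1, (1 + s) / 2)"] h1[of "(1 + s) / 2"] s ge
      by (auto simp: M_def N_def joinpaths_def max_def double)
  qed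
qed

section \<open>Conjugating translations to their squares\<close>

text \<open>
  \<open>p\<close> is a loop in \<open>S\<close> based at \<open>x0\<close>.
\<close>

definition loop_at :: "'b::topological_space set \<Rightarrow> 'b \<Rightarrow> (real \<Rightarrow> 'b) \<Rightarrow> bool" where
  "loop_at S x0 p \<longleftrightarrow> path p \<and> path_image p \<subseteq> S \<and> pathstart p = x0 \<and> pathfinish p = x0"

lemma carrier_fundamental_group:
  "carrier (fundamental_group S x0) = path_class S ` Collect (loop_at S x0)"
  by (auto simp: fundamental_group_def loop_at_def)

lemma loop_at_join: "loop_at S x0 p \<Longrightarrow> loop_at S x0 q \<Longrightarrow> loop_at S x0 (p +++ q)"
  by (simp add: loop_at_def path_image_join)

lemma mult_path_class:
  assumes "loop_at S x0 p" "loop_at S x0 q"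
  shows "path_class S p \<otimes>\<^bsub>fundamental_group S x0\<^esub> path_class S q = path_class S (p +++ q)"
proof -
  have "homotopic_paths S (p +++ q) (p' +++ q')"
    if "homotopic_paths S p p'" "homotopic_paths S q q'" for p' q'
    using assms that by (intro homotopic_paths_join) (auto simp: loop_at_def)
  moreover have "homotopic_paths S p p" "homotopic_paths S q q"
    using assms by (auto simp: loop_at_def)
  ultimately have "(\<exists>p'. homotopic_paths S p p' \<and> (\<exists>q'. homotopic_paths S q q' \<and>
      homotopic_paths S (p' +++ q') r)) \<longleftrightarrow> homotopic_paths S (p +++ q) r" for r
    by (meson homotopic_paths_trans)
  then show ?thesis
    by (simp add: fundamental_group_def path_class_def)
qed

lemma path_class_eqD:
  "path_class S p = path_class S q \<Longrightarrow> loop_at S x0 q \<Longrightarrow> homotopic_paths S p q"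
  by (auto simp: path_class_def loop_at_def set_eq_iff)

lemma iso_path_class_join:
  assumes "\<phi> \<in> iso (fundamental_group S x0) affine_group" "loop_at S x0 p" "loop_at S x0 q"
  shows "\<phi> (path_class S (p +++ q)) = \<phi> (path_class S p) \<circ> \<phi> (path_class S q)"
proof -
  have "\<phi> \<in> hom (fundamental_group S x0) affine_group" using assms by (simp add: iso_def)
  from hom_mult[OF this, of "path_class S p" "path_class S q"] assms
  show ?thesis
    by (simp add: mult_path_class carrier_fundamental_group) (simp add: affine_group_def)
qed

text \<open>
  If \<open>g\<close> represents \<open>z \<mapsto> z / 2\<close> and \<open>p\<close> represents \<open>z \<mapsto> z + b\<close>, then \<open>g p p\<close> and \<open>p g\<close> both represent
  \<open>z \<mapsto> z / 2 + b\<close>. One loop \<open>g\<close> serves all translations at once.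
\<close>

lemma conjugating_loop:
  fixes \<phi> :: "(real \<Rightarrow> 'b::topological_space) set \<Rightarrow> 'k::field \<Rightarrow> 'k"
  assumes two: "(2::'k) \<noteq> 0" and \<phi>: "\<phi> \<in> iso (fundamental_group S x0) affine_group"
  obtains g where "loop_at S x0 g"
    "\<And>p. loop_at S x0 p \<Longrightarrow> \<phi> (path_class S p) \<in> affine_translations \<Longrightarrow>
       homotopic_paths S (g +++ (p +++ p)) (p +++ g)"
proof -
  have bij: "bij_betw \<phi> (carrier (fundamental_group S x0)) (carrier affine_group)"
    using \<phi> by (simp add: iso_def)
  have "(\<lambda>z. inverse 2 * z + 0) \<in> carrier (affine_group :: ('k \<Rightarrow> 'k) monoid)"
    using two by (intro affine_groupI) simp
  then have "(\<lambda>z. inverse 2 * z + 0) \<in> \<phi> ` path_class S ` Collect (loop_at S x0)"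
    using bij unfolding bij_betw_def carrier_fundamental_group by (simp only:)
  then obtain g where g: "loop_at S x0 g" "\<phi> (path_class S g) = (\<lambda>z. inverse 2 * z + 0)"
    by (metis (no_types, lifting) imageE mem_Collect_eq)
  show thesis
  proof (rule that[OF g(1)])
    fix p assume p: "loop_at S x0 p" "\<phi> (path_class S p) \<in> affine_translations"
    then obtain b where b: "\<phi> (path_class S p) = (\<lambda>z. z + b)"
      by (auto simp: affine_translations_def)
    have half: "inverse 2 * (z + b + b) = inverse 2 * z + b" for z :: 'k
    proof -
      have "inverse 2 * (2 * b) = b" using two by (metis left_inverse mult.assoc mult_1_left)
      moreover have "z + b + b = z + 2 * b" by simp
      ultimately show ?thesis by (simp only: distrib_left)
    qed
    have loops: "loop_at S x0 (g +++ (p +++ p))" "loop_at S x0 (p +++ g)"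
      using g p by (auto intro: loop_at_join)
    have "\<phi> (path_class S (g +++ (p +++ p))) = \<phi> (path_class S (p +++ g))"
      using half two by (simp add: iso_path_class_join[OF \<phi>] loop_at_join g p(1) b fun_eq_iff)
    then have "path_class S (g +++ (p +++ p)) = path_class S (p +++ g)"
      using bij loops by (auto simp: bij_betw_def carrier_fundamental_group inj_on_def)
    then show "homotopic_paths S (g +++ (p +++ p)) (p +++ g)"
      using loops(2) by (rule path_class_eqD)
  qed
qed

section \<open>Filling the torus in the classifying space\<close>

text \<open>
  The two sides are equal as functions on all of \<open>\<real>\<close>, by periodicity, and not only homotopic.
\<close>

lemma torus_loop_double:
  "f \<circ> double_torus \<circ> torus_loop1 = (f \<circ> torus_loop1) +++ (f \<circ> torus_loop1)"
  "f \<circ> double_torus \<circ> torus_loop2 = (f \<circ> torus_loop2) +++ (f \<circ> torus_loop2)"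
proof -
  have "wrap (t - 1, 0) = wrap (t, 0)" "wrap (0, t - 1) = wrap (0, t)" for t
    using wrap_add_lattice[of "(- 1, 0)" "(t, 0)"] wrap_add_lattice[of "(0, - 1)" "(0, t)"]
    by (simp_all add: lattice_def)
  then show "f \<circ> double_torus \<circ> torus_loop1 = (f \<circ> torus_loop1) +++ (f \<circ> torus_loop1)"
    "f \<circ> double_torus \<circ> torus_loop2 = (f \<circ> torus_loop2) +++ (f \<circ> torus_loop2)"
    by (auto simp: fun_eq_iff joinpaths_def torus_loops_wrap double_torus_wrap)
qed

lemma loop_at_torus_loops:
  assumes "torus_map_for S x0 \<phi> t1 t2 f"
  shows "loop_at S x0 (f \<circ> torus_loop1)" "loop_at S x0 (f \<circ> torus_loop2)"
proof -
  have f: "continuous_on torus f" "f ` torus \<subseteq> S" "f (wrap 0) = x0" 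
    using assms by (auto simp: torus_map_for_def continuous_map_in_subtopology wrap_def)
  have w: "wrap (1, 0) = wrap 0" "wrap (0, 1) = wrap 0"
    using wrap_add_lattice[of "(1, 0)" 0] wrap_add_lattice[of "(0, 1)" 0]
    by (simp_all add: lattice_def)
  have "continuous_on {0..1} (\<lambda>t. f (wrap (t, 0)))" "continuous_on {0..1} (\<lambda>t. f (wrap (0, t)))"
    by (rule continuous_on_compose2[OF f(1)];
      auto simp: wrap_in_torus intro!: continuous_on_compose2[OF continuous_on_wrap[of UNIV]] continuous_intros)+
  then show "loop_at S x0 (f \<circ> torus_loop1)" "loop_at S x0 (f \<circ> torus_loop2)"
    using f w wrap_in_torus
    by (auto simp: loop_at_def path_def path_image_def pathstart_def pathfinish_def o_def
        torus_loops_wrap zero_prod_def)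
qed

lemma torus_map_for_double:
  fixes S :: "'b::topological_space set"
  assumes \<phi>: "\<phi> \<in> iso (fundamental_group S x0) (affine_group :: ('k::field \<Rightarrow> 'k) monoid)"
    and f: "torus_map_for S x0 \<phi> t1 t2 f"
  shows "torus_map_for S x0 \<phi> (t1 \<circ> t1) (t2 \<circ> t2) (f \<circ> double_torus)"
proof -
  have "continuous_map (top_of_set torus) (top_of_set S) (f \<circ> double_torus)"
    using f by (intro continuous_map_compose[OF continuous_map_double_torus])
      (simp add: torus_map_for_def)
  then show ?thesis
    using f loop_at_torus_loops[OF f]
    by (simp add: torus_map_for_def torus_loop_double iso_path_class_join[OF \<phi>])
       (simp add: double_torus_def)
qed

lemma affine_translations_comp:
  "t \<in> affine_translations \<Longrightarrow> t \<circ> t \<in> affine_translations"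
  by (auto simp: affine_translations_def o_def add.assoc)

text \<open>
  A free homotopy from \<open>f\<close> to \<open>f\<close> composed with doubling, read on the cube: two coordinates
  parametrize the torus and the third is time. On the boundary of the cube the homotopy is
  prescribed by the two maps and by the squares that conjugate each standard loop to its double along
  a common loop; it extends over the cube because the second homotopy group of \<open>S\<close> vanishes.
\<close>

lemma doubling_cube:
  fixes S :: "'b::topological_space set" and t1 t2 :: "'k::field \<Rightarrow> 'k"
  assumes two: "(2::'k) \<noteq> 0" and t: "t1 \<in> affine_translations" "t2 \<in> affine_translations"
    and cls: "classifying_space (affine_group :: ('k \<Rightarrow> 'k) monoid) S x0 \<phi>"
    and f: "torus_map_for S x0 \<phi> t1 t2 f"
  shows "\<exists>F. continuous_map (top_of_set cube) (top_of_set S) F \<and>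
    (\<forall>s\<in>{0..1}. \<forall>t\<in>{0..1}. F (s, t, 0) = f (wrap (s, t)) \<and>
      F (s, t, 1) = f (double_torus (wrap (s, t))) \<and>
      F (1, s, t) = F (0, s, t) \<and> F (s, 1, t) = F (s, 0, t))"
proof -
  let ?l1 = "f \<circ> torus_loop1" and ?l2 = "f \<circ> torus_loop2"
  let ?I = "{0..1::real}"
  have \<phi>: "\<phi> \<in> iso (fundamental_group S x0) affine_group"
    using cls by (simp add: classifying_space_def)
  have fc: "continuous_on torus f" "f ` torus \<subseteq> S"
    using f by (auto simp: torus_map_for_def continuous_map_in_subtopology)
  obtain g where g: "loop_at S x0 g" and conj: "\<And>p. loop_at S x0 p \<Longrightarrow>
      \<phi> (path_class S p) \<in> affine_translations \<Longrightarrow> homotopic_paths S (g +++ (p +++ p)) (p +++ g)"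
    using conjugating_loop[OF two \<phi>] by metis
  have sq: "\<exists>K. continuous_map (top_of_set (?I \<times> ?I)) (top_of_set S) K \<and>
      (\<forall>s\<in>?I. K (s, 0) = p s \<and> K (s, 1) = (p +++ p) s \<and> K (0, s) = g s \<and> K (1, s) = g s)"
    if "loop_at S x0 p" "\<phi> (path_class S p) \<in> affine_translations" for p
  proof -
    have "pathfinish g = pathstart (p +++ p)" "pathfinish p = pathstart g"
      using that g by (auto simp: loop_at_def)
    from square_of_homotopic_joins[OF conj[OF that] this] show ?thesis by metis
  qed
  obtain K1 where K1: "continuous_map (top_of_set (?I \<times> ?I)) (top_of_set S) K1"
    "\<And>s. s \<in> ?I \<Longrightarrow> K1 (s, 0) = ?l1 s" "\<And>s. s \<in> ?I \<Longrightarrow> K1 (s, 1) = f (double_torus (torus_loop1 s))"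
    "\<And>s. s \<in> ?I \<Longrightarrow> K1 (0, s) = g s" "\<And>s. s \<in> ?I \<Longrightarrow> K1 (1, s) = g s"
    using sq[OF loop_at_torus_loops(1)[OF f]] f t(1)
    unfolding torus_loop_double[symmetric] torus_map_for_def by fastforce
  obtain K2 where K2: "continuous_map (top_of_set (?I \<times> ?I)) (top_of_set S) K2"
    "\<And>s. s \<in> ?I \<Longrightarrow> K2 (s, 0) = ?l2 s" "\<And>s. s \<in> ?I \<Longrightarrow> K2 (s, 1) = f (double_torus (torus_loop2 s))"
    "\<And>s. s \<in> ?I \<Longrightarrow> K2 (0, s) = g s" "\<And>s. s \<in> ?I \<Longrightarrow> K2 (1, s) = g s"
    using sq[OF loop_at_torus_loops(2)[OF f]] f t(2)
    unfolding torus_loop_double[symmetric] torus_map_for_def by fastforce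
  have K1c: "continuous_on (?I \<times> ?I) K1" "K1 ` (?I \<times> ?I) \<subseteq> S"
    and K2c: "continuous_on (?I \<times> ?I) K2" "K2 ` (?I \<times> ?I) \<subseteq> S"
    using K1(1) K2(1) by (auto simp: continuous_map_in_subtopology)
  have w: "wrap (1, t) = wrap (0, t)" "wrap (2, t) = wrap (0, t)"
    "wrap (t, 1) = wrap (t, 0)" "wrap (t, 2) = wrap (t, 0)" for t
    using wrap_add_lattice[of "(1, 0)" "(0, t)"] wrap_add_lattice[of "(2, 0)" "(0, t)"]
      wrap_add_lattice[of "(0, 1)" "(t, 0)"] wrap_add_lattice[of "(0, 2)" "(t, 0)"]
    by (simp_all add: lattice_def)
  \<comment> \<open>The factor \<open>1 + u\<close> makes one formula serve the bottom face \<open>u = 0\<close> and the top face \<open>u = 1\<close>.\<close>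
  let ?T = "\<lambda>v. f (wrap ((1 + snd (snd v)) * fst v, (1 + snd (snd v)) * fst (snd v)))"
  let ?J = "{0, 1::real}"
  let ?A = "?I \<times> ?I \<times> ?J" and ?B = "?J \<times> ?I \<times> ?I" and ?C = "?I \<times> ?J \<times> ?I"
  let ?P = "\<lambda>v::real \<times> real \<times> real. snd (snd v) \<in> {0, 1}"
  let ?Q = "\<lambda>v::real \<times> real \<times> real. fst v \<in> {0, 1}"
  let ?W = "\<lambda>v. if ?Q v then K2 (snd v) else K1 (fst v, snd (snd v))"
  define B where "B = (\<lambda>v. if ?P v then ?T v else ?W v)"
  have K1edge: "?T v = K1 (fst v, snd (snd v))" if "v \<in> ?C" "?P v" for v
    using that K1(2)[of "fst v"] K1(3)[of "fst v"] w
    by (auto simp: torus_loops_wrap double_torus_wrap)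
  have K2edge: "?T v = K2 (snd v)" if "v \<in> ?B" "?P v" for v
    using that K2(2)[of "fst (snd v)"] K2(3)[of "fst (snd v)"] w
    by (auto simp: torus_loops_wrap double_torus_wrap)
  have corner: "K2 (snd v) = K1 (fst v, snd (snd v))" if "v \<in> ?B" "v \<in> ?C" for v
    using that K1(4,5)[of "snd (snd v)"] K2(4,5)[of "snd (snd v)"] by auto
  have closed01: "closed {0, 1::real}" by (rule finite_imp_closed) simp
  have TA: "continuous_on ?A ?T"
    by (rule continuous_on_compose2[OF fc(1)];
      auto simp: wrap_in_torus intro!: continuous_on_compose2[OF continuous_on_wrap[of UNIV]] continuous_intros)
  have "continuous_on ?B (\<lambda>v. K2 (snd v))"
    by (rule continuous_on_compose2[OF K2c(1)]) (auto intro!: continuous_intros)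
  moreover have "continuous_on ?C (\<lambda>v. K1 (fst v, snd (snd v)))"
    by (rule continuous_on_compose2[OF K1c(1)]) (auto intro!: continuous_intros)
  moreover have cl: "closed ?A" "closed ?B" "closed ?C"
    by (simp_all add: closed_Times closed01)
  ultimately have WBC: "continuous_on (?B \<union> ?C) ?W"
    using corner by (intro continuous_on_cases) auto
  have "?T v = ?W v" if "v \<in> ?B \<union> ?C" "?P v" for v
    using that K1edge[of v] K2edge[of v] by auto
  then have "\<forall>v. v \<in> ?A \<and> \<not> ?P v \<or> v \<in> ?B \<union> ?C \<and> ?P v \<longrightarrow> ?T v = ?W v"
    by (metis mem_Times_iff)
  then have "continuous_on (?A \<union> (?B \<union> ?C)) B"
    unfolding B_def by (rule continuous_on_cases[OF cl(1) closed_Un[OF cl(2,3)] TA WBC])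
  moreover have "B v \<in> S" if "v \<in> ?A \<union> (?B \<union> ?C)" for v
    using that fc(2) wrap_in_torus K1c(2) K2c(2) by (auto simp: B_def image_subset_iff)
  ultimately have "continuous_map (top_of_set cube_boundary) (top_of_set S) B"
    unfolding cube_boundary_faces by (auto simp: continuous_map_in_subtopology)
  moreover have "\<exists>c. homotopic_with (\<lambda>_. True) (nsphere 2) (top_of_set S) s (\<lambda>_. c)"
    if "continuous_map (nsphere 2) (top_of_set S) s" for s
    using cls that by (auto simp: classifying_space_def)
  ultimately obtain F where F: "continuous_map (top_of_set cube) (top_of_set S) F"
    "\<And>b. b \<in> cube_boundary \<Longrightarrow> F b = B b"
    using extend_over_cube by blast
  show ?thesis
  proof (intro exI conjI ballI, rule F(1))
    fix s t :: real assume st: "s \<in> ?I" "t \<in> ?I"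
    show "F (s, t, 0) = f (wrap (s, t))"
      using F(2)[of "(s, t, 0)"] st by (simp add: cube_boundary_faces B_def)
    show "F (s, t, 1) = f (double_torus (wrap (s, t)))"
      using F(2)[of "(s, t, 1)"] st by (simp add: cube_boundary_faces B_def double_torus_wrap)
    show "F (1, s, t) = F (0, s, t)"
      using F(2)[of "(1, s, t)"] F(2)[of "(0, s, t)"] st w
      by (auto simp: cube_boundary_faces B_def)
    show "F (s, 1, t) = F (s, 0, t)"
      using F(2)[of "(s, 1, t)"] F(2)[of "(s, 0, t)"] st w K1(4,5)
      by (auto simp: cube_boundary_faces B_def K2(4,5))
  qed
qed

text \<open>
  The six tetrahedra of the cube that correspond to the orderings of the coordinates, with the signs
  of the permutations. In the boundary of their sum the interior faces cancel in pairs, the faces on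
  opposite vertical sides of the cube cancel by periodicity, and the top minus the bottom remains.
\<close>

lemma doubling_homologous:
  fixes S :: "'b::topological_space set" and t1 t2 :: "'k::field \<Rightarrow> 'k"
  assumes two: "(2::'k) \<noteq> 0" and t: "t1 \<in> affine_translations" "t2 \<in> affine_translations"
    and cls: "classifying_space (affine_group :: ('k \<Rightarrow> 'k) monoid) S x0 \<phi>"
    and f: "torus_map_for S x0 \<phi> t1 t2 f"
  obtains y where "real_singular_chain 3 (top_of_set S) y" "l1_norm y \<le> 6"
    "real_chain_boundary 3 y =
       real_chain_map 2 (f \<circ> double_torus) torus_cycle - real_chain_map 2 f torus_cycle"
proof -
  obtain F where F: "continuous_map (top_of_set cube) (top_of_set S) F"
    "\<And>s t. s \<in> {0..1} \<Longrightarrow> t \<in> {0..1} \<Longrightarrow> F (s, t, 0) = f (wrap (s, t))"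
    "\<And>s t. s \<in> {0..1} \<Longrightarrow> t \<in> {0..1} \<Longrightarrow> F (s, t, 1) = f (double_torus (wrap (s, t)))"
    "\<And>t u. t \<in> {0..1} \<Longrightarrow> u \<in> {0..1} \<Longrightarrow> F (1, t, u) = F (0, t, u)"
    "\<And>s u. s \<in> {0..1} \<Longrightarrow> u \<in> {0..1} \<Longrightarrow> F (s, 1, u) = F (s, 0, u)"
    using doubling_cube[OF assms] by blast
  define \<sigma> where "\<sigma> = (\<lambda>a b. Poly_Mapping.single (tetrahedron F (0, 0, 0) a b (1, 1, 1)) (1::real))"
  define y where "y =
      \<sigma> (1, 0, 0) (1, 1, 0) - \<sigma> (1, 0, 0) (1, 0, 1) - \<sigma> (0, 1, 0) (1, 1, 0)
    + \<sigma> (0, 1, 0) (0, 1, 1) + \<sigma> (0, 0, 1) (1, 0, 1) - \<sigma> (0, 0, 1) (0, 1, 1)"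
  have "convex cube" unfolding cube_def by (intro convex_Times) auto
  then have \<sigma>: "real_singular_chain 3 (top_of_set S) (\<sigma> a b)" if "a \<in> cube" "b \<in> cube" for a b
    unfolding \<sigma>_def
    by (intro real_singular_chain_single singular_simplex_tetrahedron[OF F(1)])
      (use that in \<open>auto simp: cube_def\<close>)
  have chain: "real_singular_chain 3 (top_of_set S) y"
    unfolding y_def by (intro real_singular_chain_add real_singular_chain_diff \<sigma>) (auto simp: cube_def)
  have bound: "l1_norm (c + \<sigma> a b) \<le> r + 1" "l1_norm (c - \<sigma> a b) \<le> r + 1"
    if "l1_norm c \<le> r" for c a b r
    using that l1_norm_add[of c "\<sigma> a b"] l1_norm_diff[of c "\<sigma> a b"] by (simp_all add: \<sigma>_def)
  have "l1_norm y \<le> 1 + 1 + 1 + 1 + 1 + 1"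
    unfolding y_def by (intro bound) (simp add: \<sigma>_def)
  then have norm: "l1_norm y \<le> 6" by simp
  have faces:
    "triangle F (1, 0, 0) (1, 1, 0) (1, 1, 1) = triangle F (0, 0, 0) (0, 1, 0) (0, 1, 1)"
    "triangle F (1, 0, 0) (1, 0, 1) (1, 1, 1) = triangle F (0, 0, 0) (0, 0, 1) (0, 1, 1)"
    "triangle F (0, 1, 0) (1, 1, 0) (1, 1, 1) = triangle F (0, 0, 0) (1, 0, 0) (1, 0, 1)"
    "triangle F (0, 1, 0) (0, 1, 1) (1, 1, 1) = triangle F (0, 0, 0) (0, 0, 1) (1, 0, 1)"
    "triangle F (0, 0, 1) (1, 0, 1) (1, 1, 1) = triangle (f \<circ> double_torus \<circ> wrap) 0 (1, 0) (1, 1)"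
    "triangle F (0, 0, 1) (0, 1, 1) (1, 1, 1) = triangle (f \<circ> double_torus \<circ> wrap) 0 (0, 1) (1, 1)"
    "triangle F (0, 0, 0) (1, 0, 0) (1, 1, 0) = triangle (f \<circ> wrap) 0 (1, 0) (1, 1)"
    "triangle F (0, 0, 0) (0, 1, 0) (1, 1, 0) = triangle (f \<circ> wrap) 0 (0, 1) (1, 1)"
    by (rule triangle_eqI, simp add: F)+
  have "real_chain_boundary 3 y =
      real_chain_map 2 (f \<circ> double_torus) torus_cycle - real_chain_map 2 f torus_cycle"
    by (simp add: y_def \<sigma>_def real_chain_boundary_add real_chain_boundary_diff
        real_chain_boundary_tetrahedron faces torus_cycle_def torus_simplices_triangle
        real_chain_map_diff simplex_map_triangle)
  with chain norm show thesis by (rule that)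
qed

text \<open>
  If \<open>D\<close> is the doubling map, \<open>D\<^sub>* c = 4 c + \<partial>w\<close> on the torus and \<open>(f \<circ> D)\<^sub>* c = f\<^sub>* c + \<partial>y\<close> in \<open>S\<close>
  together give \<open>3 f\<^sub>* c = \<partial>(y - f\<^sub>* w)\<close>. The bound on the norm does not depend on \<open>f\<close>, \<open>t1\<close>, \<open>t2\<close>.
\<close>

lemma bounded_filling:
  fixes S :: "'b::topological_space set"
  assumes two: "(2::'k::field) \<noteq> 0"
    and cls: "classifying_space (affine_group :: ('k \<Rightarrow> 'k) monoid) S x0 \<phi>"
  obtains C where "0 \<le> C" "\<And>t1 t2 f. t1 \<in> affine_translations \<Longrightarrow> t2 \<in> affine_translations \<Longrightarrow>
      torus_map_for S x0 \<phi> t1 t2 f \<Longrightarrow>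
      \<exists>y. real_singular_chain 3 (top_of_set S) y \<and> l1_norm y \<le> C \<and>
          real_chain_boundary 3 y = real_chain_map 2 f torus_cycle"
proof -
  obtain w where w: "real_singular_chain 3 (top_of_set torus) w"
    "real_chain_map 2 double_torus torus_cycle = scale_chain 4 torus_cycle + real_chain_boundary 3 w"
    by (rule double_torus_cycle_homologous)
  show thesis
  proof (rule that[of "(6 + l1_norm w) / 3"])
    fix t1 t2 :: "'k \<Rightarrow> 'k" and f
    assume *: "t1 \<in> affine_translations" "t2 \<in> affine_translations" "torus_map_for S x0 \<phi> t1 t2 f"
    obtain y where y: "real_singular_chain 3 (top_of_set S) y" "l1_norm y \<le> 6"
      "real_chain_boundary 3 y =
         real_chain_map 2 (f \<circ> double_torus) torus_cycle - real_chain_map 2 f torus_cycle"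
      by (rule doubling_homologous[OF two *(1,2) cls *(3)])
    have f: "continuous_map (top_of_set torus) (top_of_set S) f"
      using *(3) by (simp add: torus_map_for_def)
    let ?c = "real_chain_map 2 f torus_cycle"
    define z where "z = scale_chain (1/3) (y - real_chain_map 3 f w)"
    have "real_singular_chain 3 (top_of_set S) z"
      unfolding z_def
      by (intro real_singular_chain_scale real_singular_chain_diff y(1) real_singular_chain_map[OF w(1) f])
    moreover have "l1_norm z \<le> (6 + l1_norm w) / 3"
      using l1_norm_diff[of y "real_chain_map 3 f w"] l1_norm_map[of 3 f w] y(2)
      by (simp add: z_def l1_norm_scale)
    moreover have "real_chain_boundary 3 z = ?c"
    proof -
      have "real_chain_boundary 3 (y - real_chain_map 3 f w) = scale_chain 4 ?c - ?c"
        by (simp add: real_chain_boundary_diff y(3) real_chain_map_compose w(2) real_chain_map_add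
            real_chain_map_scale real_chain_boundary_map[OF w(1)])
      also have "\<dots> = scale_chain 3 ?c"
        by (rule poly_mapping_eqI) (simp add: lookup_minus)
      finally show ?thesis by (simp add: z_def real_chain_boundary_scale scale_chain_eqs(3,5))
    qed
    ultimately show "\<exists>y. real_singular_chain 3 (top_of_set S) y \<and> l1_norm y \<le> (6 + l1_norm w) / 3 \<and>
        real_chain_boundary 3 y = ?c" by blast
  qed (simp add: l1_norm_nonneg)
qed

text \<open>
  By induction on \<open>m\<close> for all \<open>f\<close> at once: pushing \<open>shrink x\<close> forward by \<open>f\<close> is a quarter of pushing
  \<open>x\<close> forward by \<open>f\<close> composed with doubling, which belongs to the squares of the two translations.
\<close>

lemma filling_shrunk_cycles:
  fixes S :: "'b::topological_space set"
  assumes two: "(2::'k::field) \<noteq> 0"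
    and cls: "classifying_space (affine_group :: ('k \<Rightarrow> 'k) monoid) S x0 \<phi>"
  obtains C where "0 \<le> C" "\<And>t1 t2 f m. t1 \<in> affine_translations \<Longrightarrow> t2 \<in> affine_translations \<Longrightarrow>
      torus_map_for S x0 \<phi> t1 t2 f \<Longrightarrow>
      \<exists>y. real_singular_chain 3 (top_of_set S) y \<and> l1_norm y \<le> C / 4 ^ m \<and>
          real_chain_boundary 3 y = real_chain_map 2 f ((shrink ^^ m) torus_cycle)"
proof -
  obtain C where C: "0 \<le> C" and fill: "\<And>t1 t2 f.
      t1 \<in> affine_translations \<Longrightarrow> t2 \<in> affine_translations \<Longrightarrow> torus_map_for S x0 \<phi> t1 t2 f \<Longrightarrow>
      \<exists>y. real_singular_chain 3 (top_of_set S) y \<and> l1_norm y \<le> C \<and>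
          real_chain_boundary 3 y = real_chain_map 2 f torus_cycle"
    using bounded_filling[OF two cls] by metis
  have \<phi>: "\<phi> \<in> iso (fundamental_group S x0) affine_group"
    using cls by (simp add: classifying_space_def)
  show thesis
  proof (rule that[OF C])
    fix t1 t2 :: "'k \<Rightarrow> 'k" and f m
    assume "t1 \<in> affine_translations" "t2 \<in> affine_translations" "torus_map_for S x0 \<phi> t1 t2 f"
    then show "\<exists>y. real_singular_chain 3 (top_of_set S) y \<and> l1_norm y \<le> C / 4 ^ m \<and>
        real_chain_boundary 3 y = real_chain_map 2 f ((shrink ^^ m) torus_cycle)"
    proof (induction m arbitrary: t1 t2 f)
      case 0
      then show ?case using fill by simp
    next
      case (Suc m)
      from Suc.IH[OF affine_translations_comp affine_translations_comp torus_map_for_double[OF \<phi>]] Suc.prems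
      obtain y where y: "real_singular_chain 3 (top_of_set S) y" "l1_norm y \<le> C / 4 ^ m"
        "real_chain_boundary 3 y = real_chain_map 2 (f \<circ> double_torus) ((shrink ^^ m) torus_cycle)"
        by blast
      then show ?case
        by (intro exI[of _ "scale_chain (1/4) y"])
          (simp add: real_singular_chain_scale l1_norm_scale real_chain_boundary_scale
            shrink_def[of "(shrink ^^ m) torus_cycle"] real_chain_map_scale real_chain_map_compose)
    qed
  qed
qed

theorem proposition1p5:
  fixes t1 t2 :: "'k::field \<Rightarrow> 'k"
    and S :: "'b::topological_space set"
    and x0 :: 'b
    and \<phi> :: "(real \<Rightarrow> 'b) set \<Rightarrow> ('k \<Rightarrow> 'k)"
    and f :: "complex \<times> complex \<Rightarrow> 'b"
  assumes "(6::'k) \<noteq> 0"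
    and "t1 \<in> affine_translations" and "t2 \<in> affine_translations"
    and "classifying_space (affine_group :: ('k \<Rightarrow> 'k) monoid) S x0 \<phi>"
    and "torus_map_for S x0 \<phi> t1 t2 f"
  shows "simplicial_volume S f = 0"
proof -
  have two: "(2::'k) \<noteq> 0"
  proof
    assume "(2::'k) = 0"
    then have "(2::'k) * 3 = 0" by (simp only: mult_zero_left)
    then show False using assms(1) by simp
  qed
  obtain C where C: "0 \<le> C" and fill: "\<And>m. \<exists>y. real_singular_chain 3 (top_of_set S) y \<and>
      l1_norm y \<le> C / 4 ^ m \<and>
      real_chain_boundary 3 y = real_chain_map 2 f ((shrink ^^ m) torus_cycle)"
    using filling_shrunk_cycles[OF two assms(4)] assms(2,3,5) by metis
  have small: "\<exists>m. a / 4 ^ m \<le> e" if "0 < e" for a e :: real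
  proof -
    have "(\<lambda>m. a * (1/4) ^ m) \<longlonglongrightarrow> a * 0"
      by (intro tendsto_mult tendsto_const LIMSEQ_power_zero) simp
    then have "eventually (\<lambda>m. a * (1/4) ^ m < e) sequentially"
      using that by (simp add: order_tendstoD)
    then obtain m where "a * (1/4) ^ m < e"
      using eventually_happens'[OF sequentially_bot] by blast
    then have "a / 4 ^ m \<le> e" by (simp add: power_one_over)
    then show ?thesis ..
  qed
  have zero: "filling_norm S f \<epsilon> = 0" if "0 < \<epsilon>" for \<epsilon>
  proof (rule antisym)
    show "0 \<le> filling_norm S f \<epsilon>"
      unfolding filling_norm_def by (intro Inf_greatest) (auto simp: l1_norm_nonneg)
    show "filling_norm S f \<epsilon> \<le> 0"
    proof (rule ereal_le_epsilon2)
      fix e :: real assume "0 < e"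
      then have "0 < min e \<epsilon>" using that by simp
      then obtain m where m: "max 2 C / 4 ^ m \<le> min e \<epsilon>" using small by blast
      obtain y where y: "real_singular_chain 3 (top_of_set S) y" "l1_norm y \<le> C / 4 ^ m"
        "real_chain_boundary 3 y = real_chain_map 2 f ((shrink ^^ m) torus_cycle)"
        using fill by blast
      have "C / 4 ^ m \<le> max 2 C / 4 ^ m" "2 / 4 ^ m \<le> max 2 C / 4 ^ m"
        by (simp_all add: divide_right_mono)
      then have "C / 4 ^ m \<le> e" "2 / 4 ^ m \<le> \<epsilon>" using m by auto
      then have "(shrink ^^ m) torus_cycle \<in> small_torus_cycles \<epsilon>"
        using small_torus_cycles_shrink[of m] by (auto simp: small_torus_cycles_def)
      then have "filling_norm S f \<epsilon> \<le> ereal (l1_norm y)"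
        unfolding filling_norm_def using y by (intro Inf_lower) auto
      also have "\<dots> \<le> ereal e" using y(2) \<open>C / 4 ^ m \<le> e\<close> by simp
      finally show "filling_norm S f \<epsilon> \<le> 0 + ereal e" by simp
    qed
  qed
  have "eventually (\<lambda>\<epsilon>. filling_norm S f \<epsilon> = 0) (at_right 0)"
    using zero by (auto simp: eventually_at_filter)
  then have "Liminf (at_right 0) (filling_norm S f) = Liminf (at_right (0::real)) (\<lambda>_. 0)"
    by (rule Liminf_eq)
  also have "\<dots> = 0" by (rule Liminf_const) simp
  finally show ?thesis by (simp add: simplicial_volume_def)
qed

end
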